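(* Let $K$ be a field, $S=K[x_1,\ldots,x_n]$, $\mathfrak m=(x_1,\ldots,x_n)$, $s\ge 3$, and let $I=\bigcap_{i=1}^s P_i$ be a reduced (i.e. irredundant) intersection of monomial prime ideals of $S$ with $\sum_{i=1}^s P_i=\mathfrak m$. Set $$q=\min\{\dim S/(P_i+P_j):\ i\ne j,\ P_i+P_j\ne\mathfrak m\}.$$ Suppose that the big size of $I$ is $t(I)=2$ and that $I$ has the following property: whenever there exist $i\ne j$ in $\{1,\ldots,s\}$ such that $P_i+P_j\neq\mathfrak m$, there exist also $k\neq e$ in $\{1,\ldots,s\}\setminus\{i,j\}$ such that $P_k+P_e\ne\mathfrak m$. Then \begin{enumerate} \item $\operatorname{depth}_S S/I\in\{1,2,1+q\}$. \item $\operatorname{depth}_S S/I=1$ if and only if, after a renumbering of $P_1,\ldots,P_s$, there exists $1\le c<s$ such that $P_i+P_j=\mathfrak m$ for each $c<j\le s$ and $1\le i\le c$. \end{enumerate}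
   Context: A monomial prime ideal of $S$ is an ideal generated by a subset of the variables; an intersection $\bigcap_i P_i$ is reduced (irredundant) if no $P_i$ can be omitted without changing it. Big size: for $I=\bigcap_{i=1}^s P_i$ as in the claim, with $\sum_{i=1}^sP_i=\mathfrak m$, the big size $t(I)$ is the minimal number $t<s$ such that the sum of any $t+1$ (distinct) prime ideals among $P_1,\ldots,P_s$ equals $\mathfrak m$. $\dim$ is Krull dimension and $\operatorname{depth}_S$ is depth with respect to $\mathfrak m$. *)

theory Defs
  imports
    "HOL-Algebra.Algebra"
    "HOL-Algebra.Algebraic_Closure_Type"
    "HOL-Library.Poly_Mapping"
    "HOL-Library.Extended_Nat"
begin

section \<open>Polynomial rings\<close>

text \<open>
  The polynomial ring over a field \<open>'k\<close> in the variables \<open>x\<^sub>i\<close>, \<open>i :: 'n\<close>: finitely supported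
  functions from exponent vectors to \<open>'k\<close>, with convolution as product. The number of variables
  is \<open>CARD('n)\<close>.
\<close>

type_synonym ('n, 'k) mpoly = "('n \<Rightarrow>\<^sub>0 nat) \<Rightarrow>\<^sub>0 'k"

definition mpoly_ring :: "('n::finite, 'k::field) mpoly ring" where
  "mpoly_ring = ring_of_type_algebra"

definition pvar :: "'n::finite \<Rightarrow> ('n, 'k::field) mpoly" where
  "pvar i = Poly_Mapping.single (Poly_Mapping.single i 1) 1"

definition vars_ideal :: "('n::finite, 'k::field) mpoly set" where
  "vars_ideal = Idl\<^bsub>mpoly_ring\<^esub> (range pvar)"

definition monomial_prime_ideal :: "('n::finite, 'k::field) mpoly set \<Rightarrow> bool" where
  "monomial_prime_ideal P \<longleftrightarrow> (\<exists>A. P = Idl\<^bsub>mpoly_ring\<^esub> (pvar ` A))"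

section \<open>Krull dimension and depth\<close>

text \<open>The zero ring gets dimension \<open>0\<close> here (supremum of the empty set), not \<open>-\<infinity>\<close>.\<close>

definition krull_dim :: "('a, 'b) ring_scheme \<Rightarrow> enat" where
  "krull_dim R = Sup {enat n | n. \<exists>\<pp>. (\<forall>i\<le>n. primeideal (\<pp> i) R) \<and>
                                      (\<forall>i<n. \<pp> i \<subset> \<pp> (Suc i))}"

text \<open>\<open>R/I\<close> as an \<open>R\<close>-module; \<open>a\<close> acts as multiplication by its residue class \<open>I + a\<close>. The fields
  \<open>mult\<close> and \<open>one\<close> play no role in the module structure.\<close>

definition quot_module :: "('a, 'b) ring_scheme \<Rightarrow> 'a set \<Rightarrow> ('a, 'a set) module" where
  "quot_module R I =
    \<lparr>carrier = carrier (R Quot I), monoid.mult = monoid.mult (R Quot I), monoid.one = monoid.one (R Quot I),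
     ring.zero = ring.zero (R Quot I), ring.add = ring.add (R Quot I),
     module.smult = (\<lambda>a. monoid.mult (R Quot I) (I +>\<^bsub>R\<^esub> a))\<rparr>"

text \<open>The submodule \<open>JM\<close>.\<close>

definition ideal_smult :: "('a, 'c) ring_scheme \<Rightarrow> 'a set \<Rightarrow> ('a, 'b) module \<Rightarrow> 'b set" where
  "ideal_smult R J M =
    \<Inter>{N. submodule N R M \<and> {a \<odot>\<^bsub>M\<^esub> x | a x. a \<in> J \<and> x \<in> carrier M} \<subseteq> N}"

text \<open>
  The first condition says that \<open>f\<^sub>i\<close> is a nonzerodivisor on \<open>M/(f\<^sub>1,\<dots>,f\<^sub>i\<^sub>-\<^sub>1)M\<close>.
\<close>

definition regular_sequence ::
    "('a, 'c) ring_scheme \<Rightarrow> ('a, 'b) module \<Rightarrow> 'a list \<Rightarrow> bool" where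
  "regular_sequence R M fs \<longleftrightarrow> set fs \<subseteq> carrier R \<and>
     (\<forall>i<length fs. \<forall>x\<in>carrier M.
        fs ! i \<odot>\<^bsub>M\<^esub> x \<in> ideal_smult R (Idl\<^bsub>R\<^esub> (set (take i fs))) M \<longrightarrow>
        x \<in> ideal_smult R (Idl\<^bsub>R\<^esub> (set (take i fs))) M) \<and>
     ideal_smult R (Idl\<^bsub>R\<^esub> (set fs)) M \<noteq> carrier M"

definition depth :: "('a, 'c) ring_scheme \<Rightarrow> 'a set \<Rightarrow> ('a, 'b) module \<Rightarrow> enat" where
  "depth R J M =
    (if ideal_smult R J M = carrier M then \<infinity>
     else Sup {enat (length fs) | fs. regular_sequence R M fs \<and> set fs \<subseteq> J})"

section \<open>Sums of ideals and the big size\<close>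

definition ideal_sum :: "('a, 'b) ring_scheme \<Rightarrow> 'i set \<Rightarrow> ('i \<Rightarrow> 'a set) \<Rightarrow> 'a set" where
  "ideal_sum R T P = {finsum R f T | f. f \<in> (\<Pi> i\<in>T. P i)}"

text \<open>The minimum exists when \<open>s \<ge> 1\<close> and \<open>P\<^sub>1 + \<dots> + P\<^sub>s\<close> is the ideal of all variables.\<close>

definition big_size :: "nat \<Rightarrow> (nat \<Rightarrow> ('n::finite, 'k::field) mpoly set) \<Rightarrow> nat" where
  "big_size s P = (LEAST t. t < s \<and>
     (\<forall>T\<subseteq>{1..s}. card T = t + 1 \<longrightarrow> ideal_sum mpoly_ring T P = vars_ideal))"

section \<open>Sanity checks\<close>

lemma cring_mpoly_ring: "cring mpoly_ring"
  unfolding mpoly_ring_def by (rule cring_from_type_algebra)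

lemma module_quot_module:
  assumes "cring R" "ideal I R"
  shows "module R (quot_module R I)"
proof -
  interpret cring R by fact
  interpret I: ideal I R by fact
  interpret Q: cring "R Quot I" by (rule I.quotient_is_cring) fact
  have hom: "(+>\<^bsub>R\<^esub>) I \<in> ring_hom R (R Quot I)"
    by (rule I.rcos_ring_hom)
  have "abelian_group (quot_module R I)"
    by (rule abelian_groupI)
       (auto simp: quot_module_def Q.a_ac intro: Q.l_neg bexI[of _ "\<ominus>\<^bsub>R Quot I\<^esub> _"])
  then show ?thesis
    using ring_hom_closed[OF hom] ring_hom_mult[OF hom] ring_hom_add[OF hom] ring_hom_one[OF hom]
    by (intro moduleI assms(1))
       (simp_all add: quot_module_def Q.l_distr Q.r_distr Q.m_assoc)
qed

lemma (in abelian_monoid) ideal_sum_pair: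
  assumes "P i \<subseteq> carrier G" "P j \<subseteq> carrier G" "i \<noteq> j"
  shows "ideal_sum G {i, j} P = P i <+>\<^bsub>G\<^esub> P j"
proof -
  have "finsum G f {i, j} = f i \<oplus> f j" if "f i \<in> P i" "f j \<in> P j" for f
    using that assms by (subst finsum_insert) auto
  then have "ideal_sum G {i, j} P = {f i \<oplus> f j | f. f i \<in> P i \<and> f j \<in> P j}"
    unfolding ideal_sum_def by (auto simp: Pi_iff) metis+
  also have "\<dots> = P i <+>\<^bsub>G\<^esub> P j"
  proof (intro equalityI subsetI)
    fix z assume "z \<in> P i <+>\<^bsub>G\<^esub> P j"
    then obtain x y where *: "x \<in> P i" "y \<in> P j" "z = x \<oplus> y"
      by (auto simp: set_add_def')
    then show "z \<in> {f i \<oplus> f j | f. f i \<in> P i \<and> f j \<in> P j}"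
      using assms(3) by (intro CollectI exI[of _ "\<lambda>k. if k = i then x else y"]) auto
  qed (auto simp: set_add_def')
  finally show ?thesis .
qed

end

theory Submission
  imports Defs
begin

text \<open>
  Write \<open>P\<^sub>i = (x\<^sub>v : v \<notin> F\<^sub>i)\<close>. Then \<open>I\<close> is the Stanley-Reisner ideal of the simplicial complex with the
  sets \<open>F\<^sub>i\<close> as facets; they form an antichain because the intersection is reduced. As the big size
  is 2, \<open>P\<^sub>i + P\<^sub>j + P\<^sub>k = \<mm>\<close> for distinct \<open>i, j, k\<close>, so no vertex lies in three facets. Thus the complex is governed by a graph on the indices: \<open>i\<close> and \<open>j\<close> are adjacent when
  \<open>F\<^sub>i \<inter> F\<^sub>j \<noteq> \<emptyset>\<close>, that is, when \<open>P\<^sub>i + P\<^sub>j \<noteq> \<mm>\<close>, and then \<open>dim S/(P\<^sub>i + P\<^sub>j) = |F\<^sub>i \<inter> F\<^sub>j|\<close>. The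
  renumbering in the second claim exists exactly when the graph is disconnected. The theorem
  follows from the complete description

    \<^item> the depth is 1 if the graph is disconnected (\<open>depth_disconnected\<close>),
    \<^item> the depth is 2 if it is connected and some edge is not a bridge (\<open>depth_non_bridge\<close>),
    \<^item> the depth is \<open>1 + q\<close> if it is a tree (\<open>depth_tree\<close>).

  Upper bounds have to hold for every regular sequence in \<open>\<mm>\<close>, homogeneous or not. They come from
  Koszul cohomology: a regular sequence of length \<open>r\<close> on \<open>S/I\<close> forces the Koszul cohomology of
  \<open>S/I\<close> on the variables to vanish below degree \<open>r\<close> (\<open>koszul_vanishing\<close>), and one writes down
  classes that do not vanish. If removing a set \<open>C\<close> of vertices separates the complex, then there is
  a class of degree \<open>|C| + 1\<close> (\<open>regular_length_le_cut\<close>); \<open>C = \<emptyset>\<close> serves the disconnected case, and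
  \<open>C = F\<^sub>i \<inter> F\<^sub>j\<close> serves a bridge \<open>ij\<close>. An edge on a cycle of the graph gives a class of degree 2
  (\<open>regular_length_le_non_bridge\<close>), since the complex is then not simply connected.

  For the lower bounds, the vertices are coloured with \<open>r\<close> colours so that each nonempty
  \<open>F\<^sub>i \<inter> F\<^sub>j\<close> contains all of them. The sums of the variables of each colour, followed by the second
  elementary symmetric polynomial, form a regular sequence on every \<open>S/P\<^sub>i\<close>, and the first \<open>r\<close> of
  these polynomials are regular on every \<open>S/(P\<^sub>i + P\<^sub>j)\<close> for adjacent \<open>i, j\<close>. Adding the facets one by one
  along the connected graph, a Mayer-Vietoris argument (\<open>regular_inter\<close>) carries regularity over to
  \<open>S/I\<close> (\<open>regular_face_ideal\<close>). In a tree each new facet has one neighbour among the earlier ones, and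
  any \<open>r\<close> for which the colouring exists is possible, so one takes \<open>r = q\<close>; in general only \<open>r = 1\<close>
  works.

  Finally, \<open>q\<close> is defined through Krull dimension, so one needs that a polynomial ring in \<open>d\<close>
  variables over a field has dimension \<open>d\<close> (\<open>krull_dim_quot_var_ideal\<close>).
\<close>

section \<open>Ideals and regular sequences\<close>

text \<open>
  Ideals of a commutative ring are its submodules over itself.
\<close>
interpretation ideals: Modules.module "(*) :: 'a::comm_ring_1 \<Rightarrow> 'a \<Rightarrow> 'a"
  by unfold_locales (auto simp: algebra_simps)

text \<open>
  As a rewrite rule, \<open>a * (b * x) = (a * b) * x\<close> loops with associativity of multiplication.
\<close>
declare ideals.scale_scale [simp del]

abbreviation ideal_hull :: "'a::comm_ring_1 set \<Rightarrow> 'a set" where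
  "ideal_hull \<equiv> ideals.span"

abbreviation is_ideal :: "'a::comm_ring_1 set \<Rightarrow> bool" where
  "is_ideal \<equiv> ideals.subspace"

lemma is_ideal_mult_right: "is_ideal J \<Longrightarrow> x \<in> J \<Longrightarrow> x * c \<in> J"
  by (metis ideals.subspace_scale mult.commute)

lemma ideal_hull_ideal: "is_ideal J \<Longrightarrow> ideal_hull J = J"
  by simp

lemma ideal_hull_insert_iff:
  assumes "is_ideal J"
  shows "x \<in> ideal_hull (insert f J) \<longleftrightarrow> (\<exists>k. x - k * f \<in> J)"
  by (simp only: ideals.span_breakdown_eq ideal_hull_ideal[OF assms])

lemma ideal_hull_hull_Un: "ideal_hull (ideal_hull S \<union> T) = ideal_hull (S \<union> T)"
  by (simp add: ideals.span_Un ideals.span_span)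

lemma ideal_hull_Un_hull: "ideal_hull (S \<union> ideal_hull T) = ideal_hull (S \<union> T)"
  by (simp add: ideals.span_Un ideals.span_span)

lemma ideal_hull_insert_hull: "ideal_hull (insert a (ideal_hull S)) = ideal_hull (insert a S)"
  using ideal_hull_Un_hull[of "{a}" S] by simp

text \<open>
  The recursion replaces the module \<open>R/J\<close> by \<open>R/(J + (f))\<close>, so that inductions over a regular
  sequence stay within cyclic modules. The list may generate the unit ideal modulo \<open>J\<close>; for lists in a proper ideal
  that contains \<open>J\<close> this cannot happen, see \<open>depth_quot_eq\<close>.
\<close>
fun regular_seq :: "'a::comm_ring_1 set \<Rightarrow> 'a list \<Rightarrow> bool" where
  "regular_seq J [] \<longleftrightarrow> True"
| "regular_seq J (f # fs) \<longleftrightarrow> (\<forall>g. f * g \<in> J \<longrightarrow> g \<in> J) \<and> regular_seq (ideal_hull (insert f J)) fs"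

lemma regular_nth:
  assumes "is_ideal J"
  shows "regular_seq J fs \<longleftrightarrow> (\<forall>i<length fs. \<forall>g.
           fs ! i * g \<in> ideal_hull (J \<union> set (take i fs)) \<longrightarrow> g \<in> ideal_hull (J \<union> set (take i fs)))"
  using assms
proof (induction fs arbitrary: J)
  case (Cons f fs)
  let ?P = "\<lambda>J fs i. \<forall>g. fs ! i * g \<in> ideal_hull (J \<union> set (take i fs)) \<longrightarrow> g \<in> ideal_hull (J \<union> set (take i fs))"
  have 1: "(\<forall>i<length (f # fs). ?P J (f # fs) i)
      \<longleftrightarrow> ?P J (f # fs) 0 \<and> (\<forall>i<length fs. ?P J (f # fs) (Suc i))"
    unfolding length_Cons by (rule All_less_Suc2)
  have 2: "?P J (f # fs) 0 \<longleftrightarrow> (\<forall>g. f * g \<in> J \<longrightarrow> g \<in> J)"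
    by (simp add: ideal_hull_ideal[OF Cons.prems])
  have 3: "?P J (f # fs) (Suc i) \<longleftrightarrow> ?P (ideal_hull (insert f J)) fs i" for i
    by (simp add: ideal_hull_hull_Un)
  show ?case
    by (simp only: 1 2 3 regular_seq.simps Cons.IH[OF ideals.subspace_span])
qed simp

section \<open>Koszul cochains indexed by lists\<close>

text \<open>
  A cochain of degree \<open>i\<close> is an arbitrary function on lists of \<open>i\<close> ring elements, and
  \<open>koszul c [g\<^sub>0, \<dots>, g\<^sub>i] = (\<Sum>k. (-1)\<^sup>k * g\<^sub>k * c [g\<^sub>0, \<dots>, g\<^sub>k\<^sub>-\<^sub>1, g\<^sub>k\<^sub>+\<^sub>1, \<dots>, g\<^sub>i])\<close> is the Koszul differential.
  Cochains are not required to be alternating: the contraction \<open>c \<mapsto> (\<lambda>L. c (g # L))\<close> is a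
  homotopy for multiplication by \<open>g\<close> by the very recursion, and no order or signs of subsets
  have to be handled.
\<close>
fun koszul :: "('a::comm_ring_1 list \<Rightarrow> 'a) \<Rightarrow> 'a list \<Rightarrow> 'a" where
  "koszul c [] = 0"
| "koszul c (g # L) = g * c L - koszul (\<lambda>M. c (g # M)) L"

lemma koszul_add: "koszul (\<lambda>L. b L + c L) L = koszul b L + koszul c L"
  by (induction L arbitrary: b c) (auto simp: algebra_simps)

lemma koszul_diff: "koszul (\<lambda>L. b L - c L) L = koszul b L - koszul c L"
  by (induction L arbitrary: b c) (auto simp: algebra_simps)

lemma koszul_scale: "koszul (\<lambda>L. a * c L) L = a * koszul c L"
  by (induction L arbitrary: c) (auto simp: algebra_simps)

lemma koszul_minus: "koszul (\<lambda>L. - c L) L = - koszul c L"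
  using koszul_scale[of "-1" c L] by simp

lemma koszul_zero: "koszul (\<lambda>L. 0) L = 0"
  using koszul_scale[of 0 "\<lambda>_. 0" L] by simp

lemma koszul_koszul: "koszul (koszul c) L = 0"
  by (induction L arbitrary: c) (auto simp: koszul_diff koszul_scale)

lemma koszul_in_ideal:
  assumes "is_ideal J"
    and "\<And>M. set M \<subseteq> set L \<Longrightarrow> Suc (length M) = length L \<Longrightarrow> c M \<in> J"
  shows "koszul c L \<in> J"
  using assms(2)
proof (induction L arbitrary: c)
  case Nil
  then show ?case using ideals.subspace_0[OF assms(1)] by simp
next
  case (Cons g L)
  have "koszul (\<lambda>M. c (g # M)) L \<in> J"
    by (rule Cons.IH, rule Cons.prems) auto
  moreover have "g * c L \<in> J"
    by (intro ideals.subspace_scale[OF assms(1)] Cons.prems) auto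
  ultimately show ?case by (simp add: ideals.subspace_diff[OF assms(1)])
qed

lemma koszul_cong:
  assumes "\<And>M. set M \<subseteq> set L \<Longrightarrow> Suc (length M) = length L \<Longrightarrow> b M = c M"
  shows "koszul b L = koszul c L"
  using koszul_in_ideal[OF ideals.subspace_single_0, of L "\<lambda>M. b M - c M"] assms
  by (simp add: koszul_diff)

definition chains :: "'a set \<Rightarrow> nat \<Rightarrow> 'a list set" where
  "chains Z i = {L. set L \<subseteq> Z \<and> length L = i}"

definition cocycle :: "'a::comm_ring_1 set \<Rightarrow> 'a set \<Rightarrow> nat \<Rightarrow> ('a list \<Rightarrow> 'a) \<Rightarrow> bool" where
  "cocycle J Z i c \<longleftrightarrow> (\<forall>L\<in>chains Z (Suc i). koszul c L \<in> J)"

definition coboundary :: "'a::comm_ring_1 set \<Rightarrow> 'a set \<Rightarrow> nat \<Rightarrow> ('a list \<Rightarrow> 'a) \<Rightarrow> bool" where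
  "coboundary J Z i c \<longleftrightarrow> (\<exists>b. \<forall>L\<in>chains Z i. c L - koszul b L \<in> J)"

text \<open>
  Multiplication by an element of the ideal generated by \<open>Z\<close> is null-homotopic. For \<open>x \<in> Z\<close> the
  contraction with \<open>x\<close> does it, and the homotopies add up linearly.
\<close>
lemma cocycle_homotopy:
  assumes J: "is_ideal J" and c: "cocycle J Z i c" and f: "f \<in> ideal_hull Z"
  shows "coboundary J Z i (\<lambda>L. f * c L)"
  using f
proof (induction rule: ideals.span_induct_alt)
  case base
  show ?case unfolding coboundary_def
    using ideals.subspace_0[OF J] by (intro exI[of _ "\<lambda>_. 0"]) (simp add: koszul_zero)
next
  case (step a x y)
  then obtain b where b: "\<And>L. L \<in> chains Z i \<Longrightarrow> y * c L - koszul b L \<in> J"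
    unfolding coboundary_def by blast
  define b' where "b' = (\<lambda>L. a * c (x # L) + b L)"
  have "(a * x + y) * c L - koszul b' L \<in> J" if L: "L \<in> chains Z i" for L
  proof -
    have "x # L \<in> chains Z (Suc i)" using L step(1) by (auto simp: chains_def)
    then have "koszul c (x # L) \<in> J" using c by (auto simp: cocycle_def)
    then have "a * (x * c L - koszul (\<lambda>M. c (x # M)) L) \<in> J"
      using ideals.subspace_scale[OF J] by simp
    from ideals.subspace_add[OF J this b[OF L]] show ?thesis
      unfolding b'_def koszul_add koszul_scale by (simp add: algebra_simps)
  qed
  then show ?case unfolding coboundary_def by blast
qed

text \<open>
  By \<open>cocycle_homotopy\<close>, \<open>f * c\<close> is the coboundary of some \<open>b\<close> modulo \<open>J\<close>. Then \<open>b\<close> is a cocycle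
  modulo \<open>J + (f)\<close> of one degree less, hence a coboundary there by induction, and \<open>f * c\<close> is \<open>f\<close>
  times a coboundary modulo \<open>J\<close>. As \<open>f\<close> is a nonzerodivisor modulo \<open>J\<close>, it can be cancelled.
\<close>
theorem koszul_vanishing:
  assumes "is_ideal J" "regular_seq J fs" "set fs \<subseteq> ideal_hull Z" "i < length fs" "cocycle J Z i c"
  shows "coboundary J Z i c"
  using assms
proof (induction fs arbitrary: J i c)
  case (Cons f fs)
  note J = Cons.prems(1)
  have reg: "\<And>g. f * g \<in> J \<Longrightarrow> g \<in> J" using Cons.prems(2) by simp
  obtain b where b: "\<And>L. L \<in> chains Z i \<Longrightarrow> f * c L - koszul b L \<in> J"
    using cocycle_homotopy[OF J Cons.prems(5), of f] Cons.prems(3) unfolding coboundary_def by auto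
  show ?case
  proof (cases i)
    case 0
    have "f * c [] \<in> J" using b[of "[]"] 0 by (simp add: chains_def)
    then show ?thesis
      unfolding coboundary_def using reg 0 by (intro exI[of _ "\<lambda>_. 0"]) (auto simp: chains_def)
  next
    case (Suc j)
    let ?J = "ideal_hull (insert f J)"
    have "cocycle ?J Z j b"
      unfolding cocycle_def
    proof
      fix L assume "L \<in> chains Z (Suc j)"
      then have "- (f * c L - koszul b L) \<in> J" using b Suc ideals.subspace_neg[OF J] by blast
      then show "koszul b L \<in> ?J"
        by (subst ideal_hull_insert_iff[OF J], intro exI[of _ "c L"]) (simp add: mult.commute)
    qed
    then have "coboundary ?J Z j b"
      using Cons.IH[of ?J j b] Cons.prems Suc by simp
    then obtain e where "\<And>L. L \<in> chains Z j \<Longrightarrow> \<exists>k. b L - koszul e L - k * f \<in> J"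
      unfolding coboundary_def ideal_hull_insert_iff[OF J] by blast
    then obtain b' where b': "\<And>L. L \<in> chains Z j \<Longrightarrow> b L - koszul e L - b' L * f \<in> J"
      by metis
    have "c L - koszul b' L \<in> J" if L: "L \<in> chains Z i" for L
    proof -
      have "koszul (\<lambda>L. b L - koszul e L - f * b' L) L \<in> J"
        using L Suc b' by (intro koszul_in_ideal[OF J]) (auto simp: chains_def mult.commute)
      then have "koszul b L - f * koszul b' L \<in> J"
        by (simp add: koszul_diff koszul_koszul koszul_scale)
      from reg[of "c L - koszul b' L"] ideals.subspace_add[OF J b[OF L] this] show ?thesis
        by (simp add: algebra_simps)
    qed
    then show ?thesis unfolding coboundary_def by blast
  qed
qed simp

text \<open>
  This is exterior multiplication with the dual of \<open>y\<close>, the connecting map from the Koszul cohomology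
  on \<open>Z\<close> to the one on \<open>insert y Z\<close>: a list with exactly one \<open>y\<close>, at position \<open>k\<close>, is sent to
  \<open>(-1)\<^sup>k\<close> times the value of \<open>c\<close> on the remaining list, and all other lists to 0.
\<close>
fun suspend :: "'a::comm_ring_1 \<Rightarrow> ('a list \<Rightarrow> 'a) \<Rightarrow> 'a list \<Rightarrow> 'a" where
  "suspend y c [] = 0"
| "suspend y c (g # L) =
     (if g = y then (if y \<in> set L then 0 else c L) else - suspend y (\<lambda>M. c (g # M)) L)"

lemma suspend_diff: "suspend y (\<lambda>L. b L - c L) L = suspend y b L - suspend y c L"
  by (induction L arbitrary: b c) auto

lemma suspend_scale: "suspend y (\<lambda>L. a * c L) L = a * suspend y c L"
  by (induction L arbitrary: c) auto

lemma suspend_notin: "y \<notin> set L \<Longrightarrow> suspend y c L = 0"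
  by (induction L arbitrary: c) auto

lemma suspend_in_ideal:
  assumes "is_ideal J"
    and "\<And>M. set M \<subseteq> set L - {y} \<Longrightarrow> Suc (length M) = length L \<Longrightarrow> c M \<in> J"
  shows "suspend y c L \<in> J"
  using assms(2)
proof (induction L arbitrary: c)
  case (Cons g L)
  show ?case
  proof (cases "g = y")
    case True
    then show ?thesis using Cons.prems[of L] ideals.subspace_0[OF assms(1)] by auto
  next
    case False
    have "suspend y (\<lambda>M. c (g # M)) L \<in> J"
      using False by (intro Cons.IH Cons.prems) auto
    then show ?thesis using False ideals.subspace_neg[OF assms(1)] by simp
  qed
qed (simp add: ideals.subspace_0[OF assms(1)])

text \<open>
  The case \<open>g = y\<close> of the next lemma leaves a cochain that has been cut off on the lists with \<open>y\<close>;
  its differential collects the terms in which the only \<open>y\<close> is removed.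
\<close>
lemma koszul_mask:
  assumes "y \<in> set L"
  shows "koszul (\<lambda>M. if y \<in> set M then 0 else c M) L = y * suspend y c L"
  using assms
proof (induction L arbitrary: c)
  case (Cons g L)
  show ?case
  proof (cases "g = y")
    case False
    then show ?thesis using Cons.IH[of "\<lambda>M. c (g # M)"] Cons.prems by auto
  qed (simp add: koszul_zero)
qed simp

lemma koszul_suspend: "koszul (suspend y c) L = - suspend y (koszul c) L"
proof (induction L arbitrary: c)
  case (Cons g L)
  show ?case
  proof (cases "g = y")
    case False
    have "koszul (suspend y c) (g # L) = g * suspend y c L + koszul (suspend y (\<lambda>M. c (g # M))) L"
      using False by (simp add: koszul_minus)
    also have "\<dots> = g * suspend y c L - suspend y (koszul (\<lambda>M. c (g # M))) L"
      using Cons.IH[of "\<lambda>M. c (g # M)"] by simp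
    finally show ?thesis
      using False by (simp add: suspend_diff suspend_scale)
  next
    case True
    show ?thesis
    proof (cases "y \<in> set L")
      case in_L: True
      then show ?thesis using True koszul_mask[OF in_L, of c] by simp
    next
      case False
      have "koszul (\<lambda>M. if y \<in> set M then 0 else c M) L = koszul c L"
        using False by (intro koszul_cong) auto
      then show ?thesis using True False by (simp add: suspend_notin)
    qed
  qed
qed simp

lemma cocycle_suspend:
  assumes J: "is_ideal J" and "cocycle J Z i c"
  shows "cocycle J (insert y Z) (Suc i) (suspend y c)"
  unfolding cocycle_def
proof
  fix L assume L: "L \<in> chains (insert y Z) (Suc (Suc i))"
  have "suspend y (koszul c) L \<in> J"
    using assms L by (intro suspend_in_ideal[OF J]) (auto simp: cocycle_def chains_def)
  then show "koszul (suspend y c) L \<in> J"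
    by (simp add: koszul_suspend ideals.subspace_neg[OF J])
qed

text \<open>
  Evaluating at \<open>y # L\<close> undoes the suspension, up to a multiple of \<open>y\<close> and a coboundary.
\<close>
lemma coboundary_suspend:
  assumes J: "is_ideal J" and y: "y \<notin> Z"
    and c: "coboundary J (insert y Z) (Suc i) (suspend y c)"
  shows "coboundary (ideal_hull (insert y J)) Z i c"
proof -
  obtain b where b: "\<And>L. L \<in> chains (insert y Z) (Suc i) \<Longrightarrow> suspend y c L - koszul b L \<in> J"
    using c unfolding coboundary_def by blast
  have "c L - koszul (\<lambda>M. - b (y # M)) L \<in> ideal_hull (insert y J)" if L: "L \<in> chains Z i" for L
  proof -
    have "y \<notin> set L" "y # L \<in> chains (insert y Z) (Suc i)" using L y by (auto simp: chains_def)
    then have "c L - (y * b L - koszul (\<lambda>M. b (y # M)) L) \<in> J"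
      using b[of "y # L"] by simp
    then show ?thesis
      by (subst ideal_hull_insert_iff[OF J], intro exI[of _ "b L"])
         (simp add: koszul_minus algebra_simps)
  qed
  then show ?thesis unfolding coboundary_def by blast
qed

text \<open>
  A class on \<open>Z\<close> that survives modulo \<open>J + (Y)\<close> can be suspended through all elements of \<open>Y\<close> without
  dying. This moves classes up in degree by \<open>card Y\<close>, with \<open>Y\<close> joined to the index set.
\<close>
lemma coboundary_of_vanishing:
  assumes "finite Y" "is_ideal J" "Z \<inter> Y = {}" "cocycle J Z i c"
    and "\<And>d. cocycle J (Z \<union> Y) (i + card Y) d \<Longrightarrow> coboundary J (Z \<union> Y) (i + card Y) d"
  shows "coboundary (ideal_hull (J \<union> Y)) Z i c"
  using assms
proof (induction Y arbitrary: Z i c rule: finite_induct)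
  case empty
  then show ?case by (simp add: ideal_hull_ideal)
next
  case (insert y Y)
  note J = insert.prems(1)
  have "coboundary (ideal_hull (J \<union> Y)) (insert y Z) (Suc i) (suspend y c)"
  proof (rule insert.IH)
    show "cocycle J (insert y Z) (Suc i) (suspend y c)"
      by (rule cocycle_suspend[OF J insert.prems(3)])
  qed (use insert in auto)
  then have "coboundary (ideal_hull (insert y (ideal_hull (J \<union> Y)))) Z i c"
    using insert.prems by (intro coboundary_suspend) auto
  then show ?case by (simp add: ideal_hull_insert_hull)
qed

section \<open>Regular sequences on an intersection of two ideals\<close>

lemma ideal_hull_Un_iff:
  assumes "is_ideal J1" "is_ideal J2"
  shows "x \<in> ideal_hull (J1 \<union> J2) \<longleftrightarrow> (\<exists>a\<in>J1. \<exists>b\<in>J2. x = a + b)"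
  by (auto simp: ideals.span_Un ideal_hull_ideal[OF assms(1)] ideal_hull_ideal[OF assms(2)])

text \<open>
  In terms of the exact sequence of \<open>R/(J1 \<inter> J2)\<close>, \<open>R/J1 \<times> R/J2\<close> and \<open>R/(J1 + J2)\<close>: as \<open>f\<close> is a
  nonzerodivisor on the last module, the sequence stays exact modulo \<open>f\<close>.
\<close>
lemma hull_inter:
  assumes J1: "is_ideal J1" and J2: "is_ideal J2"
    and f: "\<And>g. f * g \<in> ideal_hull (J1 \<union> J2) \<Longrightarrow> g \<in> ideal_hull (J1 \<union> J2)"
  shows "ideal_hull (insert f J1) \<inter> ideal_hull (insert f J2) = ideal_hull (insert f (J1 \<inter> J2))"
proof
  have J12: "is_ideal (J1 \<inter> J2)" by (rule ideals.subspace_inter[OF J1 J2])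
  show "ideal_hull (insert f J1) \<inter> ideal_hull (insert f J2) \<subseteq> ideal_hull (insert f (J1 \<inter> J2))"
  proof
    fix u assume "u \<in> ideal_hull (insert f J1) \<inter> ideal_hull (insert f J2)"
    then obtain \<alpha> \<beta> where \<alpha>: "u - \<alpha> * f \<in> J1" and \<beta>: "u - \<beta> * f \<in> J2"
      using ideal_hull_insert_iff[OF J1] ideal_hull_insert_iff[OF J2] by auto
    have "f * (\<alpha> - \<beta>) = - (u - \<alpha> * f) + (u - \<beta> * f)" by (simp add: algebra_simps)
    then have "f * (\<alpha> - \<beta>) \<in> ideal_hull (J1 \<union> J2)"
      unfolding ideal_hull_Un_iff[OF J1 J2] using \<alpha> \<beta> ideals.subspace_neg[OF J1] by blast
    then obtain a b where ab: "a \<in> J1" "b \<in> J2" "\<alpha> - \<beta> = a + b"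
      using f ideal_hull_Un_iff[OF J1 J2] by metis
    have \<beta>_eq: "\<beta> = \<alpha> - a - b" using ab(3) by (simp add: algebra_simps)
    \<comment> \<open>Correcting the multiplier \<open>\<alpha>\<close> by \<open>a\<close> is harmless modulo \<open>J1\<close>, and
        turns it into \<open>\<beta> + b\<close>, which is as good as \<open>\<beta>\<close> modulo \<open>J2\<close>.\<close>
    have *: "u - (\<alpha> - a) * f = (u - \<alpha> * f) + f * a" "u - (\<alpha> - a) * f = (u - \<beta> * f) - f * b"
      unfolding \<beta>_eq by (simp_all add: algebra_simps)
    have "u - (\<alpha> - a) * f \<in> J1"
      unfolding *(1) by (intro ideals.subspace_add ideals.subspace_scale J1 \<alpha> ab)
    moreover have "u - (\<alpha> - a) * f \<in> J2"
      unfolding *(2) by (intro ideals.subspace_diff ideals.subspace_scale J2 \<beta> ab)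
    ultimately show "u \<in> ideal_hull (insert f (J1 \<inter> J2))"
      using ideal_hull_insert_iff[OF J12] by blast
  qed
  show "ideal_hull (insert f (J1 \<inter> J2)) \<subseteq> ideal_hull (insert f J1) \<inter> ideal_hull (insert f J2)"
    by (intro Int_greatest ideals.span_mono) auto
qed

text \<open>
  On the quotient by the intersection the depth can be larger by one than on the quotient by the sum:
  the last element of the sequence only has to be regular on \<open>R/J1\<close> and \<open>R/J2\<close>, because regularity
  passes to the submodule \<open>R/(J1 \<inter> J2)\<close> of their product once the other elements have been divided
  out.
\<close>
theorem regular_inter:
  assumes "is_ideal J1" "is_ideal J2"
    and "regular_seq J1 (fs @ [f])" "regular_seq J2 (fs @ [f])" "regular_seq (ideal_hull (J1 \<union> J2)) fs"
  shows "regular_seq (J1 \<inter> J2) (fs @ [f])"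
  using assms
proof (induction fs arbitrary: J1 J2)
  case Nil
  then show ?case by auto
next
  case (Cons h fs)
  let ?J1 = "ideal_hull (insert h J1)" and ?J2 = "ideal_hull (insert h J2)"
  have eq: "?J1 \<inter> ?J2 = ideal_hull (insert h (J1 \<inter> J2))"
    using Cons.prems by (intro hull_inter) auto
  have "ideal_hull (?J1 \<union> ?J2) = ideal_hull (insert h (ideal_hull (J1 \<union> J2)))"
    using ideal_hull_hull_Un[of "insert h J1" "insert h J2"]
    by (simp add: ideal_hull_Un_hull ideal_hull_insert_hull)
  then have "regular_seq (?J1 \<inter> ?J2) (fs @ [f])"
    using Cons.prems by (intro Cons.IH) auto
  then show ?case using Cons.prems eq by auto
qed

section \<open>Monomial prime ideals\<close>

abbreviation "keys \<equiv> Poly_Mapping.keys"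
abbreviation "lookup \<equiv> Poly_Mapping.lookup"

lemma sum_monomials: "(\<Sum>a\<in>keys p. Poly_Mapping.single a (lookup p a)) = p"
proof (rule poly_mapping_eqI)
  fix b
  have "lookup (\<Sum>a\<in>keys p. Poly_Mapping.single a (lookup p a)) b
      = (\<Sum>a\<in>keys p. if a = b then lookup p b else 0)"
    by (auto simp: lookup_sum lookup_single when_def intro: sum.cong)
  then show "lookup (\<Sum>a\<in>keys p. Poly_Mapping.single a (lookup p a)) b = lookup p b"
    by (simp add: in_keys_iff)
qed

text \<open>
  The monomial description of \<open>(x\<^sub>v : v \<in> A)\<close>, see \<open>ideal_hull_pvar\<close>. Membership is decided by the
  monomials one at a time, which makes sums and intersections of such ideals easy.
\<close>
definition var_ideal :: "'n set \<Rightarrow> ('n::finite, 'k::field) mpoly set" where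
  "var_ideal A = {p. \<forall>a\<in>keys p. \<exists>v\<in>A. lookup a v \<noteq> 0}"

lemma is_ideal_var_ideal [simp]: "is_ideal (var_ideal A :: ('n::finite, 'k::field) mpoly set)"
proof (rule ideals.subspaceI)
  show "x + y \<in> var_ideal A" if "x \<in> var_ideal A" "y \<in> var_ideal A" for x y :: "('n, 'k) mpoly"
    using that keys_add[of x y] unfolding var_ideal_def by blast
  show "c * x \<in> var_ideal A" if x: "x \<in> var_ideal A" for c x :: "('n, 'k) mpoly"
  proof -
    have "\<exists>v\<in>A. lookup a v \<noteq> 0" if a: "a \<in> keys (c * x)" for a
    proof -
      obtain b e where "a = b + e" "e \<in> keys x" using a keys_mult[of c x] by auto
      moreover obtain v where "v \<in> A" "lookup e v \<noteq> 0"
        using x calculation unfolding var_ideal_def by blast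
      ultimately show ?thesis by (intro bexI[of _ v]) (auto simp: lookup_add)
    qed
    then show ?thesis by (simp add: var_ideal_def)
  qed
qed (simp add: var_ideal_def)

lemma pvar_in_var_ideal [simp]: "(pvar v :: ('n::finite, 'k::field) mpoly) \<in> var_ideal A \<longleftrightarrow> v \<in> A"
  by (auto simp: var_ideal_def pvar_def lookup_single when_def)

lemma var_ideal_mono: "A \<subseteq> B \<Longrightarrow> var_ideal A \<subseteq> var_ideal B"
  unfolding var_ideal_def by blast

lemma var_ideal_subset_iff:
  "(var_ideal A :: ('n::finite, 'k::field) mpoly set) \<subseteq> var_ideal B \<longleftrightarrow> A \<subseteq> B"
  by (metis pvar_in_var_ideal subsetD subsetI var_ideal_mono)

lemma one_notin_var_ideal [simp]: "1 \<notin> var_ideal A"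
  by (simp add: var_ideal_def)

lemma const_coeff_var_ideal: "p \<in> var_ideal A \<Longrightarrow> lookup p 0 = 0"
  by (auto simp: var_ideal_def simp flip: not_in_keys_iff_lookup_eq_zero)

lemma ideal_hull_pvar: "ideal_hull (pvar ` A) = (var_ideal A :: ('n::finite, 'k::field) mpoly set)"
proof
  show "ideal_hull (pvar ` A) \<subseteq> (var_ideal A :: ('n, 'k) mpoly set)"
    by (rule ideals.span_minimal) auto
  show "(var_ideal A :: ('n, 'k) mpoly set) \<subseteq> ideal_hull (pvar ` A)"
  proof
    fix p :: "('n, 'k) mpoly" assume p: "p \<in> var_ideal A"
    have "Poly_Mapping.single a (lookup p a) \<in> ideal_hull (pvar ` A)" if a: "a \<in> keys p" for a
    proof -
      obtain v where v: "v \<in> A" "lookup a v \<noteq> 0" using p a unfolding var_ideal_def by blast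
      define b where "b = a - Poly_Mapping.single v 1"
      have "a = b + Poly_Mapping.single v 1"
        using v by (intro poly_mapping_eqI) (auto simp: b_def lookup_add lookup_minus lookup_single when_def)
      then have "Poly_Mapping.single a (lookup p a) = Poly_Mapping.single b (lookup p a) * pvar v"
        by (simp add: pvar_def mult_single)
      then show ?thesis
        using v by (auto intro: ideals.span_scale ideals.span_base)
    qed
    then have "(\<Sum>a\<in>keys p. Poly_Mapping.single a (lookup p a)) \<in> ideal_hull (pvar ` A)"
      by (rule ideals.span_sum)
    then show "p \<in> ideal_hull (pvar ` A)" by (simp add: sum_monomials)
  qed
qed

text \<open>
  Sums distribute over intersections for monomial ideals: a monomial of the right-hand side that
  involves no variable from \<open>B\<close> involves one from each \<open>A j\<close>.
\<close>
lemma ideal_hull_Inter_Un_var_ideal: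
  "ideal_hull ((\<Inter>j\<in>T. var_ideal (A j)) \<union> var_ideal B) =
     (\<Inter>j\<in>T. var_ideal (A j \<union> B) :: ('n::finite, 'k::field) mpoly set)"
proof
  have I: "is_ideal (\<Inter>j\<in>T. var_ideal (A j) :: ('n, 'k) mpoly set)"
    by (intro ideals.subspace_Int) simp
  show "ideal_hull ((\<Inter>j\<in>T. var_ideal (A j)) \<union> var_ideal B) \<subseteq>
     (\<Inter>j\<in>T. var_ideal (A j \<union> B) :: ('n, 'k) mpoly set)"
  proof (rule ideals.span_minimal)
    show "is_ideal (\<Inter>j\<in>T. var_ideal (A j \<union> B) :: ('n, 'k) mpoly set)"
      by (intro ideals.subspace_Int) simp
  qed (auto simp: var_ideal_def)
  show "(\<Inter>j\<in>T. var_ideal (A j \<union> B) :: ('n, 'k) mpoly set) \<subseteq>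
     ideal_hull ((\<Inter>j\<in>T. var_ideal (A j)) \<union> var_ideal B)"
  proof
    fix p :: "('n, 'k) mpoly" assume p: "p \<in> (\<Inter>j\<in>T. var_ideal (A j \<union> B))"
    have "Poly_Mapping.single a (lookup p a) \<in> ideal_hull ((\<Inter>j\<in>T. var_ideal (A j)) \<union> var_ideal B)"
      if a: "a \<in> keys p" for a
    proof (rule ideals.span_base, cases "\<exists>v\<in>B. lookup a v \<noteq> 0")
      case False
      have "\<exists>v\<in>A j. lookup a v \<noteq> 0" if "j \<in> T" for j
        using p a that False unfolding var_ideal_def by blast
      then show "Poly_Mapping.single a (lookup p a) \<in> (\<Inter>j\<in>T. var_ideal (A j)) \<union> var_ideal B"
        by (auto simp: var_ideal_def)
    qed (auto simp: var_ideal_def)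
    then have "(\<Sum>a\<in>keys p. Poly_Mapping.single a (lookup p a))
        \<in> ideal_hull ((\<Inter>j\<in>T. var_ideal (A j)) \<union> var_ideal B)"
      by (rule ideals.span_sum)
    then show "p \<in> ideal_hull ((\<Inter>j\<in>T. var_ideal (A j)) \<union> var_ideal B)" by (simp add: sum_monomials)
  qed
qed

lemma lookup_pvar_mult: "lookup (pvar v * p) (Poly_Mapping.single v 1 + a) = lookup p a"
proof -
  have "lookup (pvar v * p) (Poly_Mapping.single v 1 + a)
      = lookup (\<Sum>b\<in>keys p. Poly_Mapping.single (Poly_Mapping.single v 1 + b) (lookup p b)) (Poly_Mapping.single v 1 + a)"
    by (subst (1) sum_monomials[of p, symmetric]) (simp add: sum_distrib_left pvar_def mult_single)
  also have "\<dots> = (\<Sum>b\<in>keys p. if b = a then lookup p a else 0)"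
    by (auto simp: lookup_sum lookup_single when_def intro: sum.cong)
  also have "\<dots> = lookup p a" by (simp add: in_keys_iff)
  finally show ?thesis .
qed

section \<open>Substitution homomorphisms and primality\<close>

text \<open>
  The target is a monoid algebra over \<open>'k\<close>, in order to cover both endomorphisms of the polynomial
  ring and the embedding into the polynomials over a linearly ordered set of variables.
\<close>
definition subst :: "('n \<Rightarrow> ('a::comm_monoid_add \<Rightarrow>\<^sub>0 'k)) \<Rightarrow> ('n::finite, 'k::field) mpoly \<Rightarrow> 'a \<Rightarrow>\<^sub>0 'k" where
  "subst \<sigma> p = (\<Sum>a\<in>keys p. Poly_Mapping.single 0 (lookup p a) * (\<Prod>v\<in>UNIV. \<sigma> v ^ lookup a v))"

lemma subst_superset:
  assumes "finite B" "keys p \<subseteq> B"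
  shows "subst \<sigma> p = (\<Sum>a\<in>B. Poly_Mapping.single 0 (lookup p a) * (\<Prod>v\<in>UNIV. \<sigma> v ^ lookup a v))"
  unfolding subst_def using assms
  by (intro sum.mono_neutral_left) (auto simp: in_keys_iff)

lemma subst_zero [simp]: "subst \<sigma> 0 = 0"
  by (simp add: subst_def)

lemma subst_single:
  "subst \<sigma> (Poly_Mapping.single a c) = Poly_Mapping.single 0 c * (\<Prod>v\<in>UNIV. \<sigma> v ^ lookup a v)"
  by (subst subst_superset[of "{a}"]) auto

lemma subst_add: "subst \<sigma> (p + q) = subst \<sigma> p + subst \<sigma> q"
proof -
  have "keys (p + q) \<subseteq> keys p \<union> keys q" by (rule keys_add)
  then show ?thesis
    by (simp add: subst_superset[of "keys p \<union> keys q"] lookup_add single_add algebra_simps sum.distrib)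
qed

lemma subst_sum: "subst \<sigma> (sum f T) = (\<Sum>i\<in>T. subst \<sigma> (f i))"
  by (induction T rule: infinite_finite_induct) (auto simp: subst_add)

lemma subst_mult:
  fixes \<sigma> :: "'n::finite \<Rightarrow> 'a::comm_monoid_add \<Rightarrow>\<^sub>0 'k::field"
  shows "subst \<sigma> (p * q) = subst \<sigma> p * subst \<sigma> q"
proof -
  have *: "subst \<sigma> (Poly_Mapping.single a c * Poly_Mapping.single b d) =
        subst \<sigma> (Poly_Mapping.single a c) * subst \<sigma> (Poly_Mapping.single b d)" for a b c d
  proof -
    have "(Poly_Mapping.single 0 (c * d) :: 'a \<Rightarrow>\<^sub>0 'k) = Poly_Mapping.single 0 c * Poly_Mapping.single 0 d"
      by (simp add: mult_single)
    then show ?thesis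
      by (simp add: mult_single[of a c b d] subst_single lookup_add power_add prod.distrib mult_ac)
  qed
  have "subst \<sigma> (p * q) = subst \<sigma> ((\<Sum>a\<in>keys p. Poly_Mapping.single a (lookup p a))
      * (\<Sum>b\<in>keys q. Poly_Mapping.single b (lookup q b)))"
    by (simp only: sum_monomials)
  also have "\<dots> = subst \<sigma> (\<Sum>a\<in>keys p. Poly_Mapping.single a (lookup p a))
      * subst \<sigma> (\<Sum>b\<in>keys q. Poly_Mapping.single b (lookup q b))"
    by (simp only: sum_product subst_sum *)
  finally show ?thesis by (simp only: sum_monomials)
qed

lemma subst_pvar [simp]: "subst \<sigma> (pvar v) = \<sigma> v"
proof -
  have "(\<Prod>u\<in>UNIV. \<sigma> u ^ lookup (Poly_Mapping.single v (1::nat)) u) = (\<Prod>u\<in>UNIV. if u = v then \<sigma> u else 1)"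
    by (intro prod.cong) (auto simp: lookup_single when_def)
  then show ?thesis by (simp add: pvar_def subst_single)
qed

lemma subst_one [simp]: "subst \<sigma> 1 = 1"
  using subst_single[of \<sigma> 0 1] by simp

lemma subst_prod: "subst \<sigma> (prod f T) = (\<Prod>i\<in>T. subst \<sigma> (f i))"
  by (induction T rule: infinite_finite_induct) (auto simp: subst_mult)

lemma is_ideal_kernel: "is_ideal {p. subst \<sigma> p = 0}"
  by (rule ideals.subspaceI) (auto simp: subst_add subst_mult)

lemma single_power: "Poly_Mapping.single (Poly_Mapping.single v 1) 1 ^ m
    = Poly_Mapping.single (Poly_Mapping.single v m) (1::'k::field)"
  for v :: 'v
  by (induction m) (auto simp: mult_single simp flip: single_add)

lemma prod_single: "(\<Prod>v\<in>T. Poly_Mapping.single (x v) (1::'k::field)) = Poly_Mapping.single (\<Sum>v\<in>T. x v) 1"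
  for x :: "'v \<Rightarrow> 'a::comm_monoid_add"
  by (induction T rule: infinite_finite_induct) (auto simp: mult_single)

text \<open>
  Renaming the variables injectively moves each coefficient to the renamed monomial.
\<close>
lemma subst_vars:
  fixes p :: "('n::finite, 'k::field) mpoly" and e :: "'n \<Rightarrow> 'v"
  assumes "inj e"
  shows "lookup (subst (\<lambda>v. Poly_Mapping.single (Poly_Mapping.single (e v) 1) 1) p)
      (\<Sum>v\<in>UNIV. Poly_Mapping.single (e v) (lookup a v)) = lookup p a"
proof -
  define h where "h a = (\<Sum>v\<in>UNIV. Poly_Mapping.single (e v) (lookup a v))" for a :: "'n \<Rightarrow>\<^sub>0 nat"
  have "lookup (h a) (e v) = lookup a v" for a v
  proof -
    have "lookup (h a) (e v) = (\<Sum>u\<in>UNIV. if u = v then lookup a v else 0)"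
      unfolding h_def lookup_sum using assms
      by (intro sum.cong) (auto simp: lookup_single when_def dest: injD)
    then show ?thesis by simp
  qed
  then have h: "h a = h b \<longleftrightarrow> a = b" for a b by (metis poly_mapping_eqI)
  have "subst (\<lambda>v. Poly_Mapping.single (Poly_Mapping.single (e v) 1) 1) p
      = (\<Sum>b\<in>keys p. Poly_Mapping.single (h b) (lookup p b))"
    unfolding subst_def single_power prod_single h_def by (simp add: mult_single)
  then have "lookup (subst (\<lambda>v. Poly_Mapping.single (Poly_Mapping.single (e v) 1) 1) p) (h a)
      = (\<Sum>b\<in>keys p. if b = a then lookup p a else 0)"
    by (auto simp: lookup_sum lookup_single when_def h intro: sum.cong)
  then show ?thesis unfolding h_def by (simp add: in_keys_iff)
qed

text \<open>
  Over a linearly ordered set of variables the exponents are linearly ordered, and leading monomials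
  show that there are no zero divisors. A finite set of variables embeds into \<open>nat\<close>.
\<close>
lemma mpoly_no_zero_divisors:
  fixes p q :: "('n::finite, 'k::field) mpoly"
  assumes "p * q = 0"
  shows "p = 0 \<or> q = 0"
proof -
  obtain e :: "'n \<Rightarrow> nat" where e: "inj e"
    using finite_imp_inj_to_nat_seg[of "UNIV :: 'n set"] by auto
  let ?s = "subst (\<lambda>v. Poly_Mapping.single (Poly_Mapping.single (e v) (1::nat)) (1::'k))"
  have inj: "r = 0" if "?s r = 0" for r :: "('n, 'k) mpoly"
    using subst_vars[OF e, of r] that by (intro poly_mapping_eqI) (simp del: One_nat_def)
  have "?s p * ?s q = 0" using assms by (simp flip: subst_mult)
  then show ?thesis using inj by auto
qed

lemma subst_pvar_id: "subst pvar p = p"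
proof (rule poly_mapping_eqI)
  fix a
  have "(\<Sum>v\<in>UNIV. Poly_Mapping.single v (lookup a v)) = a" for a :: "'a \<Rightarrow>\<^sub>0 nat"
  proof (rule poly_mapping_eqI)
    fix u
    have "lookup (\<Sum>v\<in>UNIV. Poly_Mapping.single v (lookup a v)) u = (\<Sum>v\<in>UNIV. if v = u then lookup a u else 0)"
      unfolding lookup_sum by (intro sum.cong) (auto simp: lookup_single when_def)
    then show "lookup (\<Sum>v\<in>UNIV. Poly_Mapping.single v (lookup a v)) u = lookup a u" by simp
  qed
  then show "lookup (subst pvar p) a = lookup p a"
    using subst_vars[of id p a] by (simp add: pvar_def[abs_def])
qed

lemma ideal_prod_cong:
  assumes W: "is_ideal W" and "\<And>i. i \<in> T \<Longrightarrow> f i - g i \<in> W"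
  shows "prod f T - prod g T \<in> W"
  using assms(2)
proof (induction T rule: infinite_finite_induct)
  case (insert i T)
  have "prod f (insert i T) - prod g (insert i T) = f i * (prod f T - prod g T) + prod g T * (f i - g i)"
    using insert.hyps by (simp add: algebra_simps)
  then show ?case
    using insert by (auto intro!: ideals.subspace_add[OF W] ideals.subspace_scale[OF W])
qed (auto simp: ideals.subspace_0[OF W])

lemma subst_cong_ideal:
  fixes W :: "('n::finite, 'k::field) mpoly set"
  assumes W: "is_ideal W" and s: "\<And>v. \<sigma> v - pvar v \<in> W"
  shows "subst \<sigma> p - p \<in> W"
proof -
  have pow: "\<sigma> v ^ m - pvar v ^ m \<in> W" for v m
    using ideal_prod_cong[OF W, of "{..<m}" "\<lambda>_. \<sigma> v" "\<lambda>_. pvar v"] s by simp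
  have "subst \<sigma> p - subst pvar p \<in> W"
    unfolding subst_def sum_subtractf[symmetric] right_diff_distrib[symmetric]
    by (intro ideals.subspace_sum[OF W] ideals.subspace_scale[OF W] ideal_prod_cong[OF W] pow)
  then show ?thesis by (simp add: subst_pvar_id)
qed

text \<open>
  An endomorphism that kills the generators \<open>G\<close> and is the identity modulo \<open>(G)\<close> has kernel \<open>(G)\<close>, so
  the quotient embeds into a domain.
\<close>
lemma retract_prime:
  fixes G :: "('n::finite, 'k::field) mpoly set"
  assumes s: "\<And>v. \<sigma> v - pvar v \<in> ideal_hull G" and G: "\<And>g. g \<in> G \<Longrightarrow> subst \<sigma> g = 0"
    and pq: "p * q \<in> ideal_hull G"
  shows "p \<in> ideal_hull G \<or> q \<in> ideal_hull G"
proof -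
  have sub: "ideal_hull G \<subseteq> {p. subst \<sigma> p = 0}"
    using G by (intro ideals.span_minimal is_ideal_kernel) auto
  have ker: "r \<in> ideal_hull G" if "subst \<sigma> r = 0" for r
    using subst_cong_ideal[OF ideals.subspace_span s, of r] that ideals.span_neg by fastforce
  have "subst \<sigma> p * subst \<sigma> q = 0" using sub pq by (auto simp flip: subst_mult)
  then show ?thesis using mpoly_no_zero_divisors ker by blast
qed

lemma var_ideal_prime:
  fixes p q :: "('n::finite, 'k::field) mpoly"
  assumes "p * q \<in> var_ideal A"
  shows "p \<in> var_ideal A \<or> q \<in> var_ideal A"
proof -
  define \<sigma> :: "'n \<Rightarrow> ('n, 'k) mpoly" where "\<sigma> v = (if v \<in> A then 0 else pvar v)" for v
  have "\<sigma> v - pvar v \<in> ideal_hull (pvar ` A)" for v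
    by (simp add: \<sigma>_def ideals.span_zero ideals.span_neg ideals.span_base)
  moreover have "subst \<sigma> g = 0" if "g \<in> pvar ` A" for g
    using that by (auto simp: \<sigma>_def)
  moreover have "p * q \<in> ideal_hull (pvar ` A)"
    using assms by (simp add: ideal_hull_pvar)
  ultimately have "p \<in> ideal_hull (pvar ` A) \<or> q \<in> ideal_hull (pvar ` A)"
    by (rule retract_prime)
  then show ?thesis by (simp add: ideal_hull_pvar)
qed

section \<open>Regular sequences of colour sums\<close>

definition colour_sum :: "('n \<Rightarrow> nat) \<Rightarrow> nat \<Rightarrow> ('n::finite, 'k::field) mpoly" where
  "colour_sum \<chi> j = (\<Sum>v | \<chi> v = j. pvar v)"

text \<open>
  The second elementary symmetric polynomial. After all colour sums, it is a nonzerodivisor as soon as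
  two vertices have the same colour (\<open>pair_sum_notin\<close>), and this also works in characteristic 2 and over
  finite fields, where linear forms in general position need not exist.
\<close>
definition pair_sum :: "('n::finite, 'k::field) mpoly" where
  "pair_sum = (\<Sum>T | card T = 2. \<Prod>v\<in>T. pvar v)"

lemma subst_colour_sum: "subst \<sigma> (colour_sum \<chi> j) = (\<Sum>v | \<chi> v = j. \<sigma> v)"
  by (simp add: colour_sum_def subst_sum)

text \<open>
  Modulo the colour sums, one variable of each of the first \<open>k\<close> colours can be eliminated, namely by
  replacing it with minus the sum of the other variables of that colour. So the quotient is again a
  polynomial ring.
\<close>
lemma colour_ideal_prime:
  fixes p q :: "('n::finite, 'k::field) mpoly"
  assumes rep: "\<And>j. j < k \<Longrightarrow> \<exists>v. v \<notin> A \<and> \<chi> v = j"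
    and pq: "p * q \<in> ideal_hull (pvar ` A \<union> colour_sum \<chi> ` {..<k})" (is "_ \<in> ideal_hull ?G")
  shows "p \<in> ideal_hull ?G \<or> q \<in> ideal_hull ?G"
proof -
  obtain w where w: "\<And>j. j < k \<Longrightarrow> w j \<notin> A \<and> \<chi> (w j) = j" using rep by metis
  define tail :: "nat \<Rightarrow> ('n, 'k) mpoly"
    where "tail j = (\<Sum>u\<in>{u. \<chi> u = j} - {w j}. if u \<in> A then 0 else pvar u)" for j
  define \<sigma> :: "'n \<Rightarrow> ('n, 'k) mpoly"
    where "\<sigma> v = (if v \<in> A then 0 else if \<chi> v < k \<and> w (\<chi> v) = v then - tail (\<chi> v) else pvar v)" for v
  have A: "pvar v \<in> ideal_hull ?G" if "v \<in> A" for v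
    using that by (intro ideals.span_base) auto
  have "\<sigma> v - pvar v \<in> ideal_hull ?G" for v
  proof -
    consider "v \<in> A" | "v \<notin> A" "\<chi> v < k" "w (\<chi> v) = v" | "\<sigma> v = pvar v"
      unfolding \<sigma>_def by argo
    then show ?thesis
    proof cases
      case 2
      define j where "j = \<chi> v"
      have "colour_sum \<chi> j = pvar v + (\<Sum>u\<in>{u. \<chi> u = j} - {v}. (pvar u :: ('n, 'k) mpoly))"
        unfolding colour_sum_def j_def by (subst sum.remove[of _ v]) auto
      then have "\<sigma> v - pvar v = - colour_sum \<chi> j + (\<Sum>u\<in>{u. \<chi> u = j} - {v}. pvar u - (if u \<in> A then 0 else pvar u))"
        using 2 by (simp add: \<sigma>_def tail_def j_def sum_subtractf)
      moreover have "colour_sum \<chi> j \<in> ideal_hull ?G"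
        using 2 by (intro ideals.span_base) (auto simp: j_def)
      moreover have "(\<Sum>u\<in>{u. \<chi> u = j} - {v}. pvar u - (if u \<in> A then 0 else pvar u)) \<in> ideal_hull ?G"
        by (intro ideals.span_sum) (auto simp: A ideals.span_zero)
      ultimately show ?thesis by (simp only: ideals.span_add ideals.span_neg)
    qed (auto simp: \<sigma>_def A ideals.span_neg ideals.span_zero)
  qed
  moreover have "subst \<sigma> g = 0" if "g \<in> ?G" for g
    using that
  proof
    assume "g \<in> colour_sum \<chi> ` {..<k}"
    then obtain j where j: "j < k" "g = colour_sum \<chi> j" by auto
    have "(\<Sum>v | \<chi> v = j. \<sigma> v) = \<sigma> (w j) + (\<Sum>v\<in>{v. \<chi> v = j} - {w j}. \<sigma> v)"
      using w[OF j(1)] by (intro sum.remove) auto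
    also have "\<sigma> (w j) = - tail j" using w[OF j(1)] j by (simp add: \<sigma>_def)
    also have "(\<Sum>v\<in>{v. \<chi> v = j} - {w j}. \<sigma> v) = tail j"
      unfolding tail_def by (intro sum.cong) (auto simp: \<sigma>_def)
    finally show ?thesis by (simp add: j subst_colour_sum)
  qed (auto simp: \<sigma>_def)
  ultimately show ?thesis using pq by (rule retract_prime)
qed

lemma pvar_nonzero [simp]: "(pvar v :: ('n::finite, 'k::field) mpoly) \<noteq> 0"
  by (metis ideals.subspace_0 empty_iff is_ideal_var_ideal pvar_in_var_ideal)

text \<open>
  Setting all variables except \<open>x\<^sub>v\<close> to zero kills the ideal, but not the colour sum of \<open>\<chi> v\<close>.
\<close>
lemma colour_sum_notin:
  assumes "v \<notin> A" "\<chi> v = k"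
  shows "colour_sum \<chi> k \<notin> ideal_hull (pvar ` A \<union> colour_sum \<chi> ` {..<k} :: ('n::finite, 'k::field) mpoly set)"
proof
  define \<sigma> :: "'n \<Rightarrow> ('n, 'k) mpoly" where "\<sigma> u = (if u = v then pvar v else 0)" for u
  have c: "subst \<sigma> (colour_sum \<chi> j) = (if j = k then pvar v else 0)" for j
    using assms by (simp add: subst_colour_sum \<sigma>_def)
  assume "colour_sum \<chi> k \<in> ideal_hull (pvar ` A \<union> colour_sum \<chi> ` {..<k} :: ('n, 'k) mpoly set)"
  moreover have "ideal_hull (pvar ` A \<union> colour_sum \<chi> ` {..<k}) \<subseteq> {p. subst \<sigma> p = 0}"
    using assms by (intro ideals.span_minimal is_ideal_kernel) (auto simp: c \<sigma>_def)
  ultimately have "subst \<sigma> (colour_sum \<chi> k) = 0" by blast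
  then show False by (simp add: c)
qed

text \<open>
  The substitution \<open>x\<^sub>u \<mapsto> x\<^sub>u\<close>, \<open>x\<^sub>v \<mapsto> - x\<^sub>u\<close> and zero for the other variables kills every colour sum,
  since \<open>u\<close> and \<open>v\<close> have the same colour, and sends \<open>pair_sum\<close> to \<open>- x\<^sub>u\<^sup>2\<close>.
\<close>
lemma pair_sum_notin:
  assumes "u \<notin> A" "v \<notin> A" "u \<noteq> v" "\<chi> u = \<chi> v"
  shows "pair_sum \<notin> ideal_hull (pvar ` A \<union> colour_sum \<chi> ` T :: ('n::finite, 'k::field) mpoly set)"
proof
  define \<sigma> :: "'n \<Rightarrow> ('n, 'k) mpoly"
    where "\<sigma> x = (if x = u then pvar u else if x = v then - pvar u else 0)" for x
  have c: "subst \<sigma> (colour_sum \<chi> j) = 0" for j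
  proof -
    have "(\<Sum>x | \<chi> x = j. \<sigma> x) = (\<Sum>x | \<chi> x = j. (if x = u then pvar u else 0) + (if x = v then - pvar u else 0))"
      using assms(3) by (intro sum.cong) (auto simp: \<sigma>_def)
    then show ?thesis using assms(4) by (simp add: subst_colour_sum sum.distrib)
  qed
  have "(\<Prod>x\<in>T. \<sigma> x) = 0" if T: "card T = 2" "T \<noteq> {u, v}" for T
  proof -
    have "finite T" using T(1) by (simp add: card_ge_0_finite)
    moreover have "\<not> T \<subseteq> {u, v}"
      using T assms(3) card_subset_eq[of "{u, v}" T] by auto
    ultimately show ?thesis by (auto simp: \<sigma>_def intro!: prod_zero)
  qed
  then have "(\<Sum>T | card T = 2. \<Prod>x\<in>T. \<sigma> x) = (\<Sum>T | card T = 2. if T = {u, v} then \<Prod>x\<in>{u, v}. \<sigma> x else 0)"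
    by (intro sum.cong) auto
  then have s: "subst \<sigma> pair_sum = - (pvar u * pvar u)"
    using assms(3) by (simp add: pair_sum_def subst_sum subst_prod \<sigma>_def)
  assume "pair_sum \<in> ideal_hull (pvar ` A \<union> colour_sum \<chi> ` T :: ('n, 'k) mpoly set)"
  moreover have "ideal_hull (pvar ` A \<union> colour_sum \<chi> ` T) \<subseteq> {p. subst \<sigma> p = 0}"
    using assms by (intro ideals.span_minimal is_ideal_kernel) (auto simp: c \<sigma>_def)
  ultimately have "subst \<sigma> pair_sum = 0" by blast
  then show False using s mpoly_no_zero_divisors[of "pvar u" "pvar u :: ('n, 'k) mpoly"] by simp
qed

lemma regular_colour_sums:
  assumes "\<And>j. j < r \<Longrightarrow> \<exists>v. v \<notin> A \<and> \<chi> v = j"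
  shows "regular_seq (var_ideal A :: ('n::finite, 'k::field) mpoly set) (map (colour_sum \<chi>) [0..<r])"
  unfolding regular_nth[OF is_ideal_var_ideal]
proof (intro allI impI)
  fix i and g :: "('n, 'k) mpoly"
  assume "i < length (map (colour_sum \<chi> :: _ \<Rightarrow> ('n, 'k) mpoly) [0..<r])"
  then have i: "i < r" by simp
  let ?W = "ideal_hull (pvar ` A \<union> colour_sum \<chi> ` {..<i}) :: ('n, 'k) mpoly set"
  have W: "ideal_hull (var_ideal A \<union> set (take i (map (colour_sum \<chi>) [0..<r]))) = ?W"
    using i by (simp add: take_map ideal_hull_hull_Un atLeast0LessThan flip: ideal_hull_pvar)
  assume "map (colour_sum \<chi>) [0..<r] ! i * g \<in> ideal_hull (var_ideal A \<union> set (take i (map (colour_sum \<chi>) [0..<r])))"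
  then have "colour_sum \<chi> i * g \<in> ?W" unfolding W using i by simp
  then have "colour_sum \<chi> i \<in> ?W \<or> g \<in> ?W" using i assms by (intro colour_ideal_prime) auto
  moreover obtain v where "v \<notin> A" "\<chi> v = i" using assms[OF i] by blast
  ultimately show "g \<in> ideal_hull (var_ideal A \<union> set (take i (map (colour_sum \<chi>) [0..<r])))"
    unfolding W using colour_sum_notin by blast
qed

lemma regular_seq_snoc:
  "is_ideal J \<Longrightarrow> regular_seq J (fs @ [f]) \<longleftrightarrow>
     regular_seq J fs \<and> (\<forall>g. f * g \<in> ideal_hull (J \<union> set fs) \<longrightarrow> g \<in> ideal_hull (J \<union> set fs))"
proof (induction fs arbitrary: J)
  case Nil
  then show ?case by (simp add: ideal_hull_ideal)
next
  case (Cons h fs)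
  then show ?case by (simp add: ideal_hull_hull_Un)
qed

lemma regular_colour_sums_pair_sum:
  assumes "\<And>j. j < r \<Longrightarrow> \<exists>v. v \<notin> A \<and> \<chi> v = j"
    and "u \<notin> A" "v \<notin> A" "u \<noteq> v" "\<chi> u = \<chi> v"
  shows "regular_seq (var_ideal A :: ('n::finite, 'k::field) mpoly set) (map (colour_sum \<chi>) [0..<r] @ [pair_sum])"
proof -
  let ?W = "ideal_hull (pvar ` A \<union> colour_sum \<chi> ` {..<r}) :: ('n, 'k) mpoly set"
  have W: "ideal_hull (var_ideal A \<union> set (map (colour_sum \<chi>) [0..<r])) = ?W"
    by (simp add: ideal_hull_hull_Un atLeast0LessThan flip: ideal_hull_pvar)
  show ?thesis
    unfolding regular_seq_snoc[OF is_ideal_var_ideal] W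
    using regular_colour_sums[of r A \<chi>] colour_ideal_prime[of r A \<chi> pair_sum]
      pair_sum_notin[OF assms(2-5)] assms(1) by blast
qed

section \<open>Krull dimension of a polynomial ring\<close>

definition is_prime :: "'a::comm_ring_1 set \<Rightarrow> bool" where
  "is_prime Q \<longleftrightarrow> is_ideal Q \<and> 1 \<notin> Q \<and> (\<forall>x y. x * y \<in> Q \<longrightarrow> x \<in> Q \<or> y \<in> Q)"

lemma is_prime_power: "is_prime Q \<Longrightarrow> x ^ m \<in> Q \<Longrightarrow> x \<in> Q"
  by (induction m) (auto simp: is_prime_def)

text \<open>
  More vectors than coordinates are linearly dependent, by eliminating one coordinate at a time.
\<close>
lemma linear_dependence:
  fixes f :: "'e \<Rightarrow> 'z \<Rightarrow> 'k::field"
  assumes "finite Z" "finite E" "card Z < card E"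
  shows "\<exists>c. (\<exists>e\<in>E. c e \<noteq> 0) \<and> (\<forall>z\<in>Z. (\<Sum>e\<in>E. c e * f e z) = 0)"
  using assms
proof (induction Z arbitrary: E f rule: finite_induct)
  case empty
  then have "E \<noteq> {}" by auto
  then show ?case by (intro exI[of _ "\<lambda>_. 1"]) auto
next
  case (insert z Z)
  show ?case
  proof (cases "\<forall>e\<in>E. f e z = 0")
    case True
    obtain c where "\<exists>e\<in>E. c e \<noteq> 0" "\<forall>z\<in>Z. (\<Sum>e\<in>E. c e * f e z) = 0"
      using insert.IH[of E f] insert.prems insert.hyps by auto
    then show ?thesis using True by (intro exI[of _ c]) auto
  next
    case False
    then obtain p where p: "p \<in> E" "f p z \<noteq> 0" by blast
    define E' where "E' = E - {p}"
    have E: "E = insert p E'" "p \<notin> E'" "finite E'" using p insert.prems by (auto simp: E'_def)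
    define f' where "f' e y = f e y - f e z / f p z * f p y" for e y
    have "card Z < card E'" using insert.prems insert.hyps E by simp
    then obtain c where c: "\<exists>e\<in>E'. c e \<noteq> 0" "\<And>y. y \<in> Z \<Longrightarrow> (\<Sum>e\<in>E'. c e * f' e y) = 0"
      using insert.IH[of E' f'] E by auto
    define c' where "c' = c(p := - (\<Sum>e\<in>E'. c e * (f e z / f p z)))"
    have sum: "(\<Sum>e\<in>E. c' e * f e y) = (\<Sum>e\<in>E'. c e * f' e y)" for y
    proof -
      have "(\<Sum>e\<in>E. c' e * f e y) = c' p * f p y + (\<Sum>e\<in>E'. c' e * f e y)"
        using E by simp
      also have "(\<Sum>e\<in>E'. c' e * f e y) = (\<Sum>e\<in>E'. c e * f e y)"
        using E by (intro sum.cong) (auto simp: c'_def)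
      also have "c' p * f p y = - (\<Sum>e\<in>E'. c e * (f e z / f p z) * f p y)"
        by (simp add: c'_def sum_distrib_right)
      finally show ?thesis
        by (simp add: f'_def right_diff_distrib sum_subtractf mult.assoc)
    qed
    have "f' e z = 0" for e using p by (simp add: f'_def)
    then have "\<forall>y\<in>insert z Z. (\<Sum>e\<in>E. c' e * f e y) = 0" using c by (simp add: sum)
    moreover have "\<exists>e\<in>E. c' e \<noteq> 0" using c(1) E by (auto simp: c'_def)
    ultimately show ?thesis by blast
  qed
qed

fun power_product :: "(nat \<Rightarrow> 'a::comm_ring_1) \<Rightarrow> nat \<Rightarrow> nat list \<Rightarrow> 'a" where
  "power_product x k [] = 1"
| "power_product x k (m # L) = x k ^ m * power_product x (Suc k) L"

lemma lookup_const_mult: "lookup (Poly_Mapping.single 0 c * p) a = c * lookup p a"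
  for p :: "('n::finite, 'k::field) mpoly"
  unfolding mult_map_scale_conv_mult[symmetric] by transfer (simp add: when_def)

definition exps_le :: "nat \<Rightarrow> ('n::finite, 'k::field) mpoly \<Rightarrow> bool" where
  "exps_le D p \<longleftrightarrow> (\<forall>a\<in>keys p. \<forall>v. lookup a v \<le> D)"

lemma exps_le_one: "exps_le D 1"
  by (simp add: exps_le_def)

lemma exps_le_mult:
  assumes "exps_le C p" "exps_le D q"
  shows "exps_le (C + D) (p * q)"
  unfolding exps_le_def
proof (intro ballI allI)
  fix a v assume "a \<in> keys (p * q)"
  then obtain b e where "a = b + e" "b \<in> keys p" "e \<in> keys q" using keys_mult[of p q] by auto
  then show "lookup a v \<le> C + D"
    using assms unfolding exps_le_def by (simp add: lookup_add add_mono)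
qed

lemma exps_le_power: "exps_le D p \<Longrightarrow> exps_le (m * D) (p ^ m)"
  by (induction m) (auto simp: exps_le_one intro: exps_le_mult)

lemma exps_le_mono: "exps_le C p \<Longrightarrow> C \<le> D \<Longrightarrow> exps_le D p"
  unfolding exps_le_def using order_trans by blast

lemma exps_le_power_product:
  assumes "\<And>i. i < k + length L \<Longrightarrow> exps_le D (g i)" "set L \<subseteq> {..N}"
  shows "exps_le (length L * (N * D)) (power_product g k L)"
  using assms
proof (induction L arbitrary: k)
  case (Cons m L)
  have "exps_le (m * D) (g k ^ m)" using Cons.prems by (intro exps_le_power) simp
  moreover have "m * D \<le> N * D" using Cons.prems by simp
  ultimately have "exps_le (N * D) (g k ^ m)" by (rule exps_le_mono)
  moreover have "exps_le (length L * (N * D)) (power_product g (Suc k) L)"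
    using Cons.prems by (intro Cons.IH) auto
  ultimately show ?case by (simp add: exps_le_mult)
qed (simp add: exps_le_one)

lemma ex_exps_le: "finite T \<Longrightarrow> \<exists>D. \<forall>i\<in>T. exps_le D (g i)"
proof (induction T rule: finite_induct)
  case (insert i T)
  then obtain D where D: "\<forall>i\<in>T. exps_le D (g i)" by blast
  let ?S = "(\<lambda>(a, v). lookup a v) ` (keys (g i) \<times> UNIV)"
  have "exps_le (Max ?S) (g i)"
    unfolding exps_le_def by (intro ballI allI Max_ge) (auto intro: rev_image_eqI)
  then show ?case
    using D by (intro exI[of _ "max D (Max ?S)"]) (auto intro: exps_le_mono)
qed simp

lemma card_exponents:
  fixes F :: "'n::finite set" and M :: nat
  defines "Z \<equiv> {a :: 'n \<Rightarrow>\<^sub>0 nat. (\<forall>v. lookup a v \<le> M) \<and> (\<forall>v. v \<notin> F \<longrightarrow> lookup a v = 0)}"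
  shows "finite Z" "card Z \<le> (M + 1) ^ card F"
proof -
  let ?r = "\<lambda>a :: 'n \<Rightarrow>\<^sub>0 nat. restrict (lookup a) F"
  have inj: "inj_on ?r Z"
  proof (intro inj_onI poly_mapping_eqI)
    fix a b v assume ab: "a \<in> Z" "b \<in> Z" "?r a = ?r b"
    have "?r a v = ?r b v" by (simp only: ab(3))
    then show "lookup a v = lookup b v"
      using ab(1,2) by (cases "v \<in> F") (auto simp: Z_def)
  qed
  have sub: "?r ` Z \<subseteq> (F \<rightarrow>\<^sub>E {..M})" by (auto simp: Z_def)
  have fin: "finite (F \<rightarrow>\<^sub>E {..M})" by (intro finite_PiE) auto
  show "finite Z" using inj sub fin by (metis finite_imageD finite_subset)
  have "card Z \<le> card (F \<rightarrow>\<^sub>E {..M})" using inj sub fin by (rule card_inj_on_le)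
  then show "card Z \<le> (M + 1) ^ card F" by (simp add: card_PiE)
qed

text \<open>
  Any \<open>d + 1\<close> polynomials in \<open>d\<close> variables are algebraically dependent. For large \<open>N\<close> there are more
  products of them with exponents at most \<open>N\<close>, namely \<open>(N + 1)\<^sup>d\<^sup>+\<^sup>1\<close>, than monomials that can occur in
  these products, of which there are \<open>O(N\<^sup>d)\<close>. All of this is modulo the variables outside \<open>F\<close>.
\<close>
lemma algebraic_dependence:
  fixes g :: "nat \<Rightarrow> ('n::finite, 'k::field) mpoly" and F :: "'n set"
  defines "d \<equiv> card F"
  shows "\<exists>E c. finite E \<and> E \<noteq> {} \<and> (\<forall>L\<in>E. length L = Suc d \<and> c L \<noteq> 0) \<and>
    (\<Sum>L\<in>E. Poly_Mapping.single 0 (c L) * power_product g 0 L) \<in> var_ideal (- F)"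
proof -
  obtain D where D: "\<forall>i\<in>{..<Suc d}. exps_le D (g i)" using ex_exps_le[of "{..<Suc d}" g] by blast
  \<comment> \<open>With these choices \<open>M + 1 \<le> C * (N + 1)\<close>, hence \<open>(M + 1)\<^sup>d \<le> N * (N + 1)\<^sup>d < (N + 1)\<^sup>d\<^sup>+\<^sup>1\<close>.\<close>
  define C where "C = Suc d * D + 1"
  define N where "N = C ^ d"
  define M where "M = Suc d * (N * D)"
  define E where "E = {L. set L \<subseteq> {..N} \<and> length L = Suc d}"
  define Z where "Z = {a :: 'n \<Rightarrow>\<^sub>0 nat. (\<forall>v. lookup a v \<le> M) \<and> (\<forall>v. v \<notin> F \<longrightarrow> lookup a v = 0)}"
  have "M + 1 \<le> C * (N + 1)" by (simp add: M_def C_def algebra_simps)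
  then have "(M + 1) ^ d \<le> (C * (N + 1)) ^ d" by (rule power_mono) simp
  also have "\<dots> = N * (N + 1) ^ d" by (simp only: power_mult_distrib N_def)
  also have "\<dots> < (N + 1) ^ Suc d" by simp
  finally have lt: "(M + 1) ^ d < (N + 1) ^ Suc d" .
  have fin: "finite E" "finite Z" "card Z \<le> (M + 1) ^ d"
    unfolding E_def Z_def d_def
    by (rule finite_lists_length_eq card_exponents finite_atMost)+
  have "card E = (N + 1) ^ Suc d" by (simp add: E_def card_lists_length_eq)
  then have "card Z < card E" using fin lt by simp
  then obtain c where c: "\<exists>L\<in>E. c L \<noteq> 0"
      "\<And>a. a \<in> Z \<Longrightarrow> (\<Sum>L\<in>E. c L * lookup (power_product g 0 L) a) = 0"
    using linear_dependence[OF fin(2,1), of "\<lambda>L. lookup (power_product g 0 L)"] by auto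
  define E' where "E' = {L\<in>E. c L \<noteq> 0}"
  let ?p = "\<Sum>L\<in>E'. Poly_Mapping.single 0 (c L) * power_product g 0 L"
  have zero: "lookup ?p a = 0" if F: "\<forall>v. v \<notin> F \<longrightarrow> lookup a v = 0" for a
  proof -
    have "lookup ?p a = (\<Sum>L\<in>E'. c L * lookup (power_product g 0 L) a)"
      by (simp add: lookup_sum lookup_const_mult)
    also have "\<dots> = (\<Sum>L\<in>E. c L * lookup (power_product g 0 L) a)"
      using fin by (intro sum.mono_neutral_left) (auto simp: E'_def)
    also have "\<dots> = 0"
    proof (cases "a \<in> Z")
      case False
      then obtain v where v: "lookup a v > M" using F by (auto simp: Z_def not_le)
      have "lookup (power_product g 0 L) a = 0" if L: "L \<in> E" for L
      proof -
        have "exps_le (length L * (N * D)) (power_product g 0 L)"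
          using L D by (intro exps_le_power_product) (auto simp: E_def)
        then have "exps_le M (power_product g 0 L)" using L by (simp add: M_def E_def)
        then have "a \<notin> keys (power_product g 0 L)" using v unfolding exps_le_def by (meson not_le)
        then show ?thesis by (simp add: in_keys_iff)
      qed
      then show ?thesis by simp
    qed (rule c(2))
    finally show ?thesis .
  qed
  have "?p \<in> var_ideal (- F)"
    unfolding var_ideal_def
  proof (intro CollectI ballI)
    fix a assume "a \<in> keys ?p"
    then have "lookup ?p a \<noteq> 0" unfolding in_keys_iff .
    then have "\<not> (\<forall>v. v \<notin> F \<longrightarrow> lookup a v = 0)" using zero by blast
    then show "\<exists>v\<in>- F. lookup a v \<noteq> 0" by blast
  qed
  moreover have "finite E'" using fin(1) by (simp add: E'_def)
  moreover have "E' \<noteq> {}" using c(1) by (auto simp: E'_def)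
  moreover have "\<forall>L\<in>E'. length L = Suc d \<and> c L \<noteq> 0" by (auto simp: E'_def E_def)
  ultimately show ?thesis by blast
qed

text \<open>
  This argument goes back to Coquand and Lombardi. If \<open>m0\<close> is the lowest exponent
  of \<open>x\<^sub>k\<close> in the relation, then \<open>x\<^sub>k\<^sup>m\<^sup>0\<close> can be cancelled modulo the prime \<open>Q k\<close>, which does not contain
  \<open>x\<^sub>k\<close>. Modulo \<open>Q (k + 1)\<close>, which contains \<open>x\<^sub>k\<close>, only the terms with exponent \<open>m0\<close> remain, and they
  form a relation between the later elements. In the end a unit lies in a prime ideal.
\<close>
lemma prime_chain_no_relation:
  fixes Q :: "nat \<Rightarrow> 'a::comm_ring_1 set"
  assumes "\<And>i. k \<le> i \<Longrightarrow> i \<le> k + m \<Longrightarrow> is_prime (Q i)"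
    and "\<And>i. k \<le> i \<Longrightarrow> i < k + m \<Longrightarrow> Q i \<subseteq> Q (Suc i) \<and> x i \<in> Q (Suc i) - Q i"
    and "finite E" "E \<noteq> {}" "\<And>L. L \<in> E \<Longrightarrow> length L = m \<and> c L dvd 1"
  shows "(\<Sum>L\<in>E. c L * power_product x k L) \<notin> Q k"
  using assms
proof (induction m arbitrary: k E c)
  case 0
  have E: "E = {[]}" using 0(4,5) by fastforce
  have Q: "is_prime (Q k)" using 0(1)[of k] by simp
  show ?case
  proof
    assume "(\<Sum>L\<in>E. c L * power_product x k L) \<in> Q k"
    then have "c [] \<in> Q k" by (simp add: E)
    moreover obtain e where "1 = c [] * e" using 0(5)[of "[]"] E by (auto elim: dvdE)
    ultimately show False using Q is_ideal_mult_right unfolding is_prime_def by metis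
  qed
next
  case (Suc m)
  define m0 where "m0 = Min (hd ` E)"
  have m0: "m0 \<le> hd L" if "L \<in> E" for L using that Suc.prems by (simp add: m0_def)
  have Q: "is_prime (Q k)" "is_prime (Q (Suc k))" using Suc.prems(1) by auto
  then have I: "is_ideal (Q (Suc k))" by (simp add: is_prime_def)
  have xk: "Q k \<subseteq> Q (Suc k)" "x k \<in> Q (Suc k)" "x k \<notin> Q k" using Suc.prems(2)[of k] by auto
  let ?t = "\<lambda>L. c L * x k ^ (hd L - m0) * power_product x (Suc k) (tl L)"
  define E0 where "E0 = {L\<in>E. hd L = m0}"
  have E0: "E0 = (#) m0 ` {L. m0 # L \<in> E}"
  proof
    show "E0 \<subseteq> (#) m0 ` {L. m0 # L \<in> E}"
    proof
      fix L assume "L \<in> E0"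
      moreover then have "L \<noteq> []" using Suc.prems(5)[of L] by (auto simp: E0_def)
      ultimately show "L \<in> (#) m0 ` {L. m0 # L \<in> E}"
        by (intro image_eqI[of _ _ "tl L"]) (auto simp: E0_def)
    qed
  qed (auto simp: E0_def)
  show ?case
  proof
    assume rel: "(\<Sum>L\<in>E. c L * power_product x k L) \<in> Q k"
    have "c L * power_product x k L = x k ^ m0 * ?t L" if in_E: "L \<in> E" for L
    proof -
      obtain a L' where L: "L = a # L'" using Suc.prems(5)[OF in_E] by (cases L) auto
      then have "a = m0 + (a - m0)" using m0[OF in_E] by simp
      then have "x k ^ a = x k ^ m0 * x k ^ (a - m0)" by (metis power_add)
      then show ?thesis by (simp add: L mult_ac)
    qed
    then have "x k ^ m0 * (\<Sum>L\<in>E. ?t L) \<in> Q k" using rel by (simp add: sum_distrib_left)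
    then have "(\<Sum>L\<in>E. ?t L) \<in> Q k"
      using Q(1) xk is_prime_power unfolding is_prime_def by metis
    then have all: "(\<Sum>L\<in>E. ?t L) \<in> Q (Suc k)" using xk by blast
    have split: "(\<Sum>L\<in>E. ?t L) = (\<Sum>L\<in>E0. ?t L) + (\<Sum>L\<in>E - E0. ?t L)"
      using Suc.prems(3) by (intro sum.subset_diff[THEN trans[OF _ add.commute]]) (auto simp: E0_def)
    have rest: "(\<Sum>L\<in>E - E0. ?t L) \<in> Q (Suc k)"
    proof (rule ideals.subspace_sum[OF I])
      fix L assume L: "L \<in> E - E0"
      then have "hd L - m0 \<noteq> 0" using m0[of L] by (auto simp: E0_def)
      then obtain j where "hd L - m0 = Suc j" using not0_implies_Suc by blast
      then have "?t L = (c L * x k ^ j * power_product x (Suc k) (tl L)) * x k"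
        by (simp add: mult_ac)
      then show "?t L \<in> Q (Suc k)" using xk ideals.subspace_scale[OF I] by metis
    qed
    have "(\<Sum>L\<in>E0. ?t L) \<in> Q (Suc k)"
      using ideals.subspace_diff[OF I all rest] unfolding split by simp
    then have "(\<Sum>L | m0 # L \<in> E. c (m0 # L) * power_product x (Suc k) L) \<in> Q (Suc k)"
      by (simp add: E0 sum.reindex)
    moreover have "(\<Sum>L | m0 # L \<in> E. c (m0 # L) * power_product x (Suc k) L) \<notin> Q (Suc k)"
    proof (rule Suc.IH)
      have "finite E0" using Suc.prems(3) by (simp add: E0_def)
      then show "finite {L. m0 # L \<in> E}" unfolding E0 by (rule finite_imageD) simp
      have "m0 \<in> hd ` E" unfolding m0_def using Suc.prems by (intro Min_in) auto
      then have "E0 \<noteq> {}" by (auto simp: E0_def)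
      then show "{L. m0 # L \<in> E} \<noteq> {}" unfolding E0 by blast
      show "length L = m \<and> c (m0 # L) dvd 1" if "L \<in> {L. m0 # L \<in> E}" for L
        using Suc.prems(5)[of "m0 # L"] that by simp
    qed (use Suc.prems(1,2) in auto)
    ultimately show False by contradiction
  qed
qed

text \<open>
  Choose an element in each difference \<open>Q (i + 1) - Q i\<close>. If the chain were longer than the number of
  variables outside \<open>A\<close>, these elements would be algebraically dependent modulo \<open>var_ideal A\<close>.
\<close>
theorem prime_chain_length_le:
  fixes Q :: "nat \<Rightarrow> ('n::finite, 'k::field) mpoly set"
  assumes Q: "\<And>i. i \<le> n \<Longrightarrow> is_prime (Q i)" and mono: "\<And>i. i < n \<Longrightarrow> Q i \<subset> Q (Suc i)"
    and A: "var_ideal A \<subseteq> Q 0"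
  shows "n \<le> card (- A)"
proof (rule ccontr)
  assume "\<not> n \<le> card (- A)"
  then have n: "Suc (card (- A)) \<le> n" by simp
  have "\<exists>y. y \<in> Q (Suc i) - Q i" if "i < n" for i using mono[OF that] by blast
  then obtain x where x: "\<And>i. i < n \<Longrightarrow> x i \<in> Q (Suc i) - Q i" by metis
  obtain E c where E: "finite E" "E \<noteq> {}" "\<forall>L\<in>E. length L = Suc (card (- A)) \<and> c L \<noteq> 0"
      "(\<Sum>L\<in>E. Poly_Mapping.single 0 (c L) * power_product x 0 L) \<in> var_ideal A"
    using algebraic_dependence[of "- A" x] by (auto simp: double_complement)
  have "(\<Sum>L\<in>E. Poly_Mapping.single 0 (c L) * power_product x 0 L) \<notin> Q 0"
  proof (rule prime_chain_no_relation)
    show "length L = Suc (card (- A)) \<and> Poly_Mapping.single 0 (c L) dvd (1 :: ('n, 'k) mpoly)" if "L \<in> E" for L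
    proof
      have "(1 :: ('n, 'k) mpoly) = Poly_Mapping.single 0 (c L) * Poly_Mapping.single 0 (1 / c L)"
        using E(3) that by (simp add: mult_single)
      then show "Poly_Mapping.single 0 (c L) dvd (1 :: ('n, 'k) mpoly)" by (rule dvdI)
    qed (use E that in auto)
    show "Q i \<subseteq> Q (Suc i) \<and> x i \<in> Q (Suc i) - Q i" if "i < 0 + Suc (card (- A))" for i
      using mono[of i] x[of i] n that by auto
  qed (use Q n E in auto)
  then show False using E(4) A by blast
qed

lemma is_prime_var_ideal: "is_prime (var_ideal A :: ('n::finite, 'k::field) mpoly set)"
  unfolding is_prime_def using var_ideal_prime by auto

lemma ex_prime_chain:
  "\<exists>Q. (\<forall>i\<le>card (- A). is_prime (Q i :: ('n::finite, 'k::field) mpoly set)) \<and>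
      (\<forall>i<card (- A). Q i \<subset> Q (Suc i)) \<and> (\<forall>i. var_ideal A \<subseteq> Q i)"
proof -
  obtain h where h: "bij_betw h {0..<card (- A)} (- A)" using ex_bij_betw_nat_finite[of "- A"] by auto
  let ?B = "\<lambda>i. A \<union> h ` {0..<i}"
  have "var_ideal (?B i) \<subset> (var_ideal (?B (Suc i)) :: ('n, 'k) mpoly set)" if i: "i < card (- A)" for i
  proof -
    have "h i \<notin> A" using h i by (auto simp: bij_betw_def)
    moreover have "h i \<notin> h ` {0..<i}" using h i by (auto simp: bij_betw_def dest!: inj_onD)
    ultimately have "\<not> ?B (Suc i) \<subseteq> ?B i" by (auto simp: atLeast0_lessThan_Suc)
    then show ?thesis unfolding psubset_eq
      by (metis Un_mono image_mono ivl_subset le_SucI order_refl subset_refl var_ideal_subset_iff)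
  qed
  then show ?thesis
    by (intro exI[of _ "\<lambda>i. var_ideal (?B i)"]) (auto simp: is_prime_var_ideal intro: var_ideal_mono[THEN subsetD])
qed

section \<open>Quotients by an ideal, as rings and as modules\<close>

context
  fixes R :: "'a::comm_ring_1 ring"
  defines R_eq: "R \<equiv> ring_of_type_algebra"
begin

lemma type_ring_simps [simp]:
  "carrier R = UNIV" "x \<otimes>\<^bsub>R\<^esub> y = x * y" "x \<oplus>\<^bsub>R\<^esub> y = x + y" "\<zero>\<^bsub>R\<^esub> = 0" "\<one>\<^bsub>R\<^esub> = 1"
  by (simp_all add: R_eq ring_of_type_algebra_def)

lemma type_cring: "cring R"
  unfolding R_eq by (rule cring_from_type_algebra)

interpretation cring R by (rule type_cring)

lemma type_minus [simp]: "\<ominus>\<^bsub>R\<^esub> x = - x"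
  using minus_equality[of "- x" x] by simp

lemma ideal_iff: "ideal J R \<longleftrightarrow> is_ideal J"
proof
  assume "ideal J R"
  then interpret ideal J R .
  show "is_ideal J"
    using a_closed zero_closed I_l_closed by (intro ideals.subspaceI) auto
next
  assume J: "is_ideal J"
  have "subgroup J (add_monoid R)"
    using ideals.subspace_0[OF J] ideals.subspace_add[OF J] ideals.subspace_neg[OF J]
    by (intro add.subgroupI) (auto simp flip: a_inv_def)
  then show "ideal J R"
    using ideals.subspace_scale[OF J] is_ideal_mult_right[OF J] by (intro idealI ring_axioms) auto
qed

lemma genideal_eq: "Idl\<^bsub>R\<^esub> S = ideal_hull S"
  unfolding genideal_def ideal_iff ideals.span_def hull_def by blast

lemma set_add_eq_hull:
  assumes "is_ideal J" "is_ideal K"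
  shows "J <+>\<^bsub>R\<^esub> K = ideal_hull (J \<union> K)"
  unfolding set_add_def' using ideal_hull_Un_iff[OF assms] by auto

lemma coset_eq_iff:
  assumes I: "is_ideal I"
  shows "I +>\<^bsub>R\<^esub> a = I +>\<^bsub>R\<^esub> b \<longleftrightarrow> a - b \<in> I"
  using quotient_eq_iff_same_a_r_cos[of I a b] I by (simp add: ideal_iff a_minus_def)

context
  fixes I :: "'a set"
  assumes I: "is_ideal I"
begin

lemma quot_module_simps [simp]:
  "carrier (quot_module R I) = range (\<lambda>a. I +>\<^bsub>R\<^esub> a)"
  "a \<odot>\<^bsub>quot_module R I\<^esub> (I +>\<^bsub>R\<^esub> b) = I +>\<^bsub>R\<^esub> (a * b)"
  "(I +>\<^bsub>R\<^esub> a) \<oplus>\<^bsub>quot_module R I\<^esub> (I +>\<^bsub>R\<^esub> b) = I +>\<^bsub>R\<^esub> (a + b)"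
  "\<zero>\<^bsub>quot_module R I\<^esub> = I +>\<^bsub>R\<^esub> 0"
proof -
  interpret ideal I R using I by (simp add: ideal_iff)
  show "carrier (quot_module R I) = range (\<lambda>a. I +>\<^bsub>R\<^esub> a)"
    by (auto simp: quot_module_def FactRing_def A_RCOSETS_def')
  show "a \<odot>\<^bsub>quot_module R I\<^esub> (I +>\<^bsub>R\<^esub> b) = I +>\<^bsub>R\<^esub> (a * b)"
    using rcoset_mult_add[of a b] by (simp add: quot_module_def FactRing_def)
  show "(I +>\<^bsub>R\<^esub> a) \<oplus>\<^bsub>quot_module R I\<^esub> (I +>\<^bsub>R\<^esub> b) = I +>\<^bsub>R\<^esub> (a + b)"
    using a_rcos_sum[of a b] by (simp add: quot_module_def FactRing_def)
  show "\<zero>\<^bsub>quot_module R I\<^esub> = I +>\<^bsub>R\<^esub> 0"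
    using a_rcos_const[of 0] zero_closed by (simp add: quot_module_def FactRing_def)
qed

lemma quot_module_minus: "\<ominus>\<^bsub>quot_module R I\<^esub> (I +>\<^bsub>R\<^esub> a) = I +>\<^bsub>R\<^esub> (- a)"
proof -
  interpret M: Module.module R "quot_module R I"
    using I by (intro module_quot_module type_cring) (simp add: ideal_iff)
  show ?thesis
    by (rule M.minus_equality) auto
qed

lemma ideal_smult_quot:
  assumes J: "is_ideal J"
  shows "ideal_smult R J (quot_module R I) = (\<lambda>a. I +>\<^bsub>R\<^esub> a) ` ideal_hull (I \<union> J)"
proof
  interpret M: Module.module R "quot_module R I"
    using I by (intro module_quot_module type_cring) (simp add: ideal_iff)
  let ?N = "(\<lambda>a. I +>\<^bsub>R\<^esub> a) ` ideal_hull (I \<union> J)"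
  let ?G = "{a \<odot>\<^bsub>quot_module R I\<^esub> x | a x. a \<in> J \<and> x \<in> carrier (quot_module R I)}"
  have "submodule ?N R (quot_module R I)"
  proof (rule M.submoduleI)
    show "\<zero>\<^bsub>quot_module R I\<^esub> \<in> ?N" by (simp add: imageI ideals.span_zero)
    show "\<ominus>\<^bsub>quot_module R I\<^esub> x \<in> ?N" if "x \<in> ?N" for x
      using that by (elim imageE) (simp add: quot_module_minus ideals.span_neg)
    show "x \<oplus>\<^bsub>quot_module R I\<^esub> y \<in> ?N" if "x \<in> ?N" "y \<in> ?N" for x y
      using that by (elim imageE) (simp add: ideals.span_add)
    show "a \<odot>\<^bsub>quot_module R I\<^esub> x \<in> ?N" if "x \<in> ?N" for a x
      using that by (elim imageE) (simp add: ideals.span_scale)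
  qed auto
  moreover have "?G \<subseteq> ?N"
  proof clarify
    fix a x assume a: "a \<in> J" and "x \<in> carrier (quot_module R I)"
    then obtain b where "x = I +>\<^bsub>R\<^esub> b" by auto
    moreover have "a * b \<in> ideal_hull (I \<union> J)"
      using is_ideal_mult_right[OF J a] by (simp add: ideals.span_base)
    ultimately show "a \<odot>\<^bsub>quot_module R I\<^esub> x \<in> ?N" by simp
  qed
  ultimately show "ideal_smult R J (quot_module R I) \<subseteq> ?N"
    unfolding ideal_smult_def by blast
  show "?N \<subseteq> ideal_smult R J (quot_module R I)"
    unfolding ideal_smult_def
  proof clarify
    fix a N assume a: "a \<in> ideal_hull (I \<union> J)" and N: "submodule N R (quot_module R I)" "?G \<subseteq> N"
    obtain i j where ij: "i \<in> I" "j \<in> J" "a = i + j" using a ideal_hull_Un_iff[OF I J] by blast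
    have "j \<odot>\<^bsub>quot_module R I\<^esub> (I +>\<^bsub>R\<^esub> 1) \<in> ?G"
      using ij(2)
      by (intro CollectI exI[of _ j] exI[of _ "I +>\<^bsub>R\<^esub> 1"] conjI refl) (simp_all add: imageI)
    then have "I +>\<^bsub>R\<^esub> j \<in> N" using N by auto
    moreover have "I +>\<^bsub>R\<^esub> a = I +>\<^bsub>R\<^esub> j" using ij by (simp add: coset_eq_iff[OF I])
    ultimately show "I +>\<^bsub>R\<^esub> a \<in> N" by simp
  qed
qed

lemma coset_in_ideal_smult_iff:
  assumes J: "is_ideal J"
  shows "I +>\<^bsub>R\<^esub> a \<in> ideal_smult R J (quot_module R I) \<longleftrightarrow> a \<in> ideal_hull (I \<union> J)"
proof
  assume "I +>\<^bsub>R\<^esub> a \<in> ideal_smult R J (quot_module R I)"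
  then obtain b where b: "b \<in> ideal_hull (I \<union> J)" "I +>\<^bsub>R\<^esub> a = I +>\<^bsub>R\<^esub> b"
    unfolding ideal_smult_quot[OF J] by blast
  then have "a - b \<in> ideal_hull (I \<union> J)"
    using ideals.span_base[of "a - b" "I \<union> J"] by (simp add: coset_eq_iff[OF I])
  from ideals.span_add[OF this b(1)] show "a \<in> ideal_hull (I \<union> J)" by simp
qed (simp add: ideal_smult_quot[OF J])

lemma ideal_smult_eq_carrier_iff:
  assumes J: "is_ideal J"
  shows "ideal_smult R J (quot_module R I) = carrier (quot_module R I) \<longleftrightarrow> ideal_hull (I \<union> J) = UNIV"
proof
  assume "ideal_smult R J (quot_module R I) = carrier (quot_module R I)"
  then show "ideal_hull (I \<union> J) = UNIV"
    using coset_in_ideal_smult_iff[OF J] by auto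
qed (simp add: ideal_smult_quot[OF J])

lemma regular_sequence_quot_iff:
  "regular_sequence R (quot_module R I) fs \<longleftrightarrow> regular_seq I fs \<and> ideal_hull (I \<union> set fs) \<noteq> UNIV"
proof -
  have 1: "(\<forall>x\<in>carrier (quot_module R I). f \<odot>\<^bsub>quot_module R I\<^esub> x \<in> ideal_smult R (Idl\<^bsub>R\<^esub> S) (quot_module R I)
      \<longrightarrow> x \<in> ideal_smult R (Idl\<^bsub>R\<^esub> S) (quot_module R I))
    \<longleftrightarrow> (\<forall>g. f * g \<in> ideal_hull (I \<union> S) \<longrightarrow> g \<in> ideal_hull (I \<union> S))" for f S
    by (simp add: genideal_eq coset_in_ideal_smult_iff ideal_hull_Un_hull)
  show ?thesis
    unfolding regular_sequence_def 1 regular_nth[OF I]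
    by (simp only: genideal_eq ideal_smult_eq_carrier_iff[OF ideals.subspace_span] ideal_hull_Un_hull) simp
qed

text \<open>
  Inside a proper ideal \<open>m\<close> that contains \<open>I\<close>, the nonvanishing of the last quotient in the definition
  of a regular sequence is automatic.
\<close>
lemma depth_quot_eq:
  assumes m: "is_ideal m" "m \<noteq> UNIV" "I \<subseteq> m"
  shows "depth R m (quot_module R I) = Sup {enat (length fs) | fs. regular_seq I fs \<and> set fs \<subseteq> m}"
proof -
  have ne: "ideal_hull (I \<union> S) \<noteq> UNIV" if "S \<subseteq> m" for S
    using ideals.span_minimal[of "I \<union> S" m] m that by auto
  have "regular_sequence R (quot_module R I) fs \<and> set fs \<subseteq> m \<longleftrightarrow> regular_seq I fs \<and> set fs \<subseteq> m" for fs
    using ne[of "set fs"] by (auto simp: regular_sequence_quot_iff)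
  moreover have "ideal_smult R m (quot_module R I) \<noteq> carrier (quot_module R I)"
    unfolding ideal_smult_eq_carrier_iff[OF m(1)] using ne[of m] by simp
  ultimately show ?thesis unfolding depth_def by (simp only: if_False)
qed

lemma depth_quot_eqI:
  assumes m: "is_ideal m" "m \<noteq> UNIV" "I \<subseteq> m"
    and fs: "regular_seq I fs" "set fs \<subseteq> m"
    and max: "\<And>gs. regular_seq I gs \<Longrightarrow> set gs \<subseteq> m \<Longrightarrow> length gs \<le> length fs"
  shows "depth R m (quot_module R I) = enat (length fs)"
  unfolding depth_quot_eq[OF m] using fs max
  by (intro cSup_eq_maximum) auto

lemma krull_dim_quot_le:
  assumes "\<And>Q n. (\<And>i. i \<le> n \<Longrightarrow> is_prime (Q i)) \<Longrightarrow> (\<And>i. i < n \<Longrightarrow> Q i \<subset> Q (Suc i)) \<Longrightarrow> I \<subseteq> Q 0 \<Longrightarrow> n \<le> d"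
  shows "krull_dim (R Quot I) \<le> enat d"
  unfolding krull_dim_def
proof (intro Sup_least, clarify)
  fix n \<pp> assume p: "\<forall>i\<le>n. primeideal (\<pp> i) (R Quot I)" "\<forall>i<n. \<pp> i \<subset> \<pp> (Suc i)"
  have idI: "ideal I R" using I by (simp add: ideal_iff)
  define Q where "Q i = {a. I +>\<^bsub>R\<^esub> a \<in> \<pp> i}" for i
  have hom: "(+>\<^bsub>R\<^esub>) I \<in> ring_hom R (R Quot I)" by (rule ideal.rcos_ring_hom[OF idI])
  interpret H: ring_hom_ring R "R Quot I" "(+>\<^bsub>R\<^esub>) I" by (rule ideal.rcos_ring_hom_ring[OF idI])
  have carr: "carrier (R Quot I) = range (\<lambda>a. I +>\<^bsub>R\<^esub> a)"
    by (auto simp: FactRing_def A_RCOSETS_def')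
  have "is_prime (Q i)" if i: "i \<le> n" for i
  proof -
    interpret P: primeideal "\<pp> i" "R Quot I" using p i by blast
    have "ideal (Q i) R" using H.ideal_vimage[OF P.is_ideal] by (simp add: Q_def)
    moreover have "1 \<notin> Q i"
      using P.I_notcarr P.one_imp_carrier H.hom_one by (auto simp: Q_def)
    moreover have "x \<in> Q i \<or> y \<in> Q i" if "x * y \<in> Q i" for x y
      using that H.hom_mult[of x y] P.I_prime[of "I +>\<^bsub>R\<^esub> x" "I +>\<^bsub>R\<^esub> y"] by (auto simp: Q_def carr)
    ultimately show ?thesis by (simp add: is_prime_def ideal_iff)
  qed
  moreover have "Q i \<subset> Q (Suc i)" if i: "i < n" for i
  proof -
    have "primeideal (\<pp> (Suc i)) (R Quot I)" using p i by simp
    then have "\<pp> (Suc i) \<subseteq> carrier (R Quot I)"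
      by (meson additive_subgroup.a_subset ideal.axioms(1) primeideal.axioms(1))
    moreover have "\<pp> i \<subset> \<pp> (Suc i)" using p i by simp
    ultimately show ?thesis unfolding carr Q_def by blast
  qed
  moreover have "I \<subseteq> Q 0"
  proof
    fix a assume a: "a \<in> I"
    interpret P: primeideal "\<pp> 0" "R Quot I" using p by blast
    have "I +>\<^bsub>R\<^esub> a = I +>\<^bsub>R\<^esub> 0" using a by (simp add: coset_eq_iff[OF I])
    also have "\<dots> = \<zero>\<^bsub>R Quot I\<^esub>" using H.hom_zero by simp
    finally have "I +>\<^bsub>R\<^esub> a = \<zero>\<^bsub>R Quot I\<^esub>" .
    then show "a \<in> Q 0" using P.zero_closed by (simp add: Q_def)
  qed
  ultimately have "n \<le> d" by (rule assms)
  then show "enat n \<le> enat d" by simp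
qed

lemma krull_dim_quot_ge:
  assumes Q: "\<And>i. i \<le> n \<Longrightarrow> is_prime (Q i)" "\<And>i. i < n \<Longrightarrow> Q i \<subset> Q (Suc i)" "\<And>i. i \<le> n \<Longrightarrow> I \<subseteq> Q i"
  shows "enat n \<le> krull_dim (R Quot I)"
  unfolding krull_dim_def
proof (intro Sup_upper CollectI exI conjI refl)
  have idI: "ideal I R" using I by (simp add: ideal_iff)
  interpret H: ring_hom_ring R "R Quot I" "(+>\<^bsub>R\<^esub>) I" by (rule ideal.rcos_ring_hom_ring[OF idI])
  have carr: "carrier (R Quot I) = range (\<lambda>a. I +>\<^bsub>R\<^esub> a)"
    by (auto simp: FactRing_def A_RCOSETS_def')
  have mem: "I +>\<^bsub>R\<^esub> a \<in> (+>\<^bsub>R\<^esub>) I ` Q i \<longleftrightarrow> a \<in> Q i" if i: "i \<le> n" for i a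
  proof
    assume "I +>\<^bsub>R\<^esub> a \<in> (+>\<^bsub>R\<^esub>) I ` Q i"
    then obtain b where b: "b \<in> Q i" "a - b \<in> I" by (auto simp: coset_eq_iff[OF I])
    have "is_ideal (Q i)" using Q(1)[OF i] by (simp add: is_prime_def)
    from ideals.subspace_add[OF this, of "a - b" b] show "a \<in> Q i" using b Q(3)[OF i] by auto
  qed auto
  show "\<forall>i\<le>n. primeideal ((+>\<^bsub>R\<^esub>) I ` Q i) (R Quot I)"
  proof (intro allI impI primeidealI)
    fix i assume i: "i \<le> n"
    show "ideal ((+>\<^bsub>R\<^esub>) I ` Q i) (R Quot I)"
      using Q(1)[OF i] by (intro ring_ideal_imp_quot_ideal idI) (simp add: ideal_iff is_prime_def)
    show "cring (R Quot I)" by (rule ideal.quotient_is_cring[OF idI type_cring])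
    show "carrier (R Quot I) \<noteq> (+>\<^bsub>R\<^esub>) I ` Q i"
      using mem[OF i, of 1] Q(1)[OF i] unfolding carr is_prime_def by blast
    fix a b assume "a \<in> carrier (R Quot I)" "b \<in> carrier (R Quot I)"
      and ab: "a \<otimes>\<^bsub>R Quot I\<^esub> b \<in> (+>\<^bsub>R\<^esub>) I ` Q i"
    then obtain x y where xy: "a = I +>\<^bsub>R\<^esub> x" "b = I +>\<^bsub>R\<^esub> y" by (auto simp: carr)
    then have "I +>\<^bsub>R\<^esub> (x * y) \<in> (+>\<^bsub>R\<^esub>) I ` Q i" using ab H.hom_mult[of x y] by simp
    then have "x * y \<in> Q i" by (simp only: mem[OF i])
    then show "a \<in> (+>\<^bsub>R\<^esub>) I ` Q i \<or> b \<in> (+>\<^bsub>R\<^esub>) I ` Q i"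
      using Q(1)[OF i] unfolding xy mem[OF i] is_prime_def by blast
  qed
  show "\<forall>i<n. (+>\<^bsub>R\<^esub>) I ` Q i \<subset> (+>\<^bsub>R\<^esub>) I ` Q (Suc i)"
  proof (intro allI impI)
    fix i assume i: "i < n"
    obtain a where a: "a \<in> Q (Suc i)" "a \<notin> Q i" using Q(2)[OF i] by blast
    have "I +>\<^bsub>R\<^esub> a \<notin> (+>\<^bsub>R\<^esub>) I ` Q i" using a mem[of i a] i by simp
    then show "(+>\<^bsub>R\<^esub>) I ` Q i \<subset> (+>\<^bsub>R\<^esub>) I ` Q (Suc i)" using a Q(2)[OF i] by blast
  qed
qed (rule refl)

end

lemma ideal_sum_subset:
  assumes "finite T" "is_ideal J" "\<And>i. i \<in> T \<Longrightarrow> P i \<subseteq> J"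
  shows "ideal_sum R T P \<subseteq> J"
proof -
  have "finsum R f T \<in> J" if "f \<in> (\<Pi> i\<in>T. P i)" for f
    using assms(1,3) that
  proof (induction T rule: finite_induct)
    case (insert i T)
    have "finsum R f (insert i T) = f i + finsum R f T"
      using insert.hyps by (subst finsum_insert) auto
    moreover have "f i \<in> J" "finsum R f T \<in> J" using insert by auto
    ultimately show ?case using ideals.subspace_add[OF assms(2)] by simp
  qed (simp add: ideals.subspace_0[OF assms(2)])
  then show ?thesis unfolding ideal_sum_def by blast
qed

end

lemma genideal_mpoly: "Idl\<^bsub>mpoly_ring\<^esub> (pvar ` A) = (var_ideal A :: ('n::finite, 'k::field) mpoly set)"
  unfolding mpoly_ring_def genideal_eq ideal_hull_pvar ..

lemma krull_dim_quot_var_ideal: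
  "krull_dim (mpoly_ring Quot (var_ideal A :: ('n::finite, 'k::field) mpoly set)) = enat (card (- A))"
proof (rule antisym)
  show "krull_dim (mpoly_ring Quot (var_ideal A :: ('n, 'k) mpoly set)) \<le> enat (card (- A))"
    unfolding mpoly_ring_def
  proof (rule krull_dim_quot_le[OF is_ideal_var_ideal])
    fix Q :: "nat \<Rightarrow> ('n, 'k) mpoly set" and n
    assume "\<And>i. i \<le> n \<Longrightarrow> is_prime (Q i)" "\<And>i. i < n \<Longrightarrow> Q i \<subset> Q (Suc i)" "var_ideal A \<subseteq> Q 0"
    then show "n \<le> card (- A)" by (rule prime_chain_length_le)
  qed
  obtain Q :: "nat \<Rightarrow> ('n, 'k) mpoly set" where Q:
      "(\<forall>i\<le>card (- A). is_prime (Q i)) \<and> (\<forall>i<card (- A). Q i \<subset> Q (Suc i)) \<and> (\<forall>i. var_ideal A \<subseteq> Q i)"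
    using ex_prime_chain[of A] by (elim exE)
  show "enat (card (- A)) \<le> krull_dim (mpoly_ring Quot (var_ideal A :: ('n, 'k) mpoly set))"
    unfolding mpoly_ring_def
  proof (rule krull_dim_quot_ge[OF is_ideal_var_ideal])
    show "is_prime (Q i)" if "i \<le> card (- A)" for i using Q that by simp
    show "Q i \<subset> Q (Suc i)" if "i < card (- A)" for i using Q that by simp
    show "var_ideal A \<subseteq> Q i" for i using Q by simp
  qed
qed

section \<open>A vertex cut bounds the length of regular sequences\<close>

lemma inj_pvar: "inj (pvar :: 'n::finite \<Rightarrow> ('n, 'k::field) mpoly)"
proof (rule injI)
  fix u v :: 'n assume "(pvar u :: ('n, 'k) mpoly) = pvar v"
  then have "(pvar u :: ('n, 'k) mpoly) \<in> var_ideal {v}" by simp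
  then show "u = v" by (simp only: pvar_in_var_ideal) simp
qed

lemma pvar_image_iff [simp]: "(pvar v :: ('n::finite, 'k::field) mpoly) \<in> pvar ` V \<longleftrightarrow> v \<in> V"
  using inj_pvar by (rule inj_image_mem_iff)

lemma pvar_mult_in_var_ideal:
  fixes p :: "('n::finite, 'k::field) mpoly"
  shows "pvar v * p \<in> var_ideal A \<longleftrightarrow> v \<in> A \<or> p \<in> var_ideal A"
proof
  show "v \<in> A \<or> p \<in> var_ideal A" if "pvar v * p \<in> var_ideal A"
    using var_ideal_prime[OF that] by simp
  show "pvar v * p \<in> var_ideal A" if "v \<in> A \<or> p \<in> var_ideal A"
    using that ideals.subspace_scale[OF is_ideal_var_ideal, of p A "pvar v"]
      is_ideal_mult_right[OF is_ideal_var_ideal, of "pvar v" A p] by auto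
qed

text \<open>
  On the variables outside \<open>C\<close>, the function that is \<open>x\<^sub>g\<close> at \<open>x\<^sub>g\<close> for \<open>g \<in> V1\<close> and 0 for \<open>g \<in> V2\<close> is
  a cocycle of degree 1, because all products \<open>x\<^sub>g x\<^sub>h\<close> across the cut are in \<open>I\<close>. It is not a
  coboundary modulo \<open>I + (C)\<close>: it would have to be multiplication by one element \<open>b\<close>, whose constant
  coefficient would be 1 by looking at \<open>V1\<close>, and 0 by looking at \<open>V2\<close>. Suspended through \<open>C\<close>, it gives a
  nonzero class of degree \<open>card C + 1\<close>.
\<close>
lemma regular_length_le_cut:
  fixes I :: "('n::finite, 'k::field) mpoly set"
  assumes I: "is_ideal I" and fs: "regular_seq I fs" "set fs \<subseteq> var_ideal UNIV"
    and disj: "V1 \<inter> V2 = {}" "V1 \<inter> C = {}" "V2 \<inter> C = {}" and cover: "V1 \<union> V2 \<union> C = UNIV"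
    and cut: "\<And>g h. g \<in> V1 \<Longrightarrow> h \<in> V2 \<Longrightarrow> pvar g * pvar h \<in> I"
    and g: "g \<in> V1" "g \<notin> A" "I \<subseteq> var_ideal A"
    and h: "h \<in> V2" "h \<notin> B" "I \<subseteq> var_ideal B"
  shows "length fs \<le> card C + 1"
proof (rule ccontr)
  assume "\<not> length fs \<le> card C + 1"
  then have len: "1 + card (pvar ` C :: ('n, 'k) mpoly set) < length fs"
    by (simp add: card_image inj_on_subset[OF inj_pvar])
  let ?Z = "pvar ` (V1 \<union> V2) :: ('n, 'k) mpoly set" and ?Y = "pvar ` C :: ('n, 'k) mpoly set"
  define c where "c L = (if hd L \<in> pvar ` V1 then hd L else 0)" for L :: "('n, 'k) mpoly list"
  have ZY: "?Z \<union> ?Y = range pvar" using cover by (simp flip: image_Un)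
  have "coboundary (ideal_hull (I \<union> ?Y)) ?Z 1 c"
  proof (rule coboundary_of_vanishing)
    show "?Z \<inter> ?Y = {}" using disj by (subst image_Int[OF inj_pvar, symmetric]) auto
    show "cocycle I ?Z 1 c"
      unfolding cocycle_def
    proof
      fix L :: "('n, 'k) mpoly list" assume "L \<in> chains ?Z (Suc 1)"
      then obtain u v where L: "L = [pvar u, pvar v]" "u \<in> V1 \<union> V2" "v \<in> V1 \<union> V2"
        by (auto simp: chains_def length_Suc_conv)
      have "koszul c L = pvar u * (if v \<in> V1 then pvar v else 0) - pvar v * (if u \<in> V1 then pvar u else 0)"
        by (simp add: L(1) c_def)
      moreover have "pvar u * pvar v \<in> I" if "u \<in> V1 \<longleftrightarrow> v \<notin> V1"
        using that L(2,3) cut[of u v] cut[of v u] by (auto simp: mult.commute)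
      ultimately show "koszul c L \<in> I"
        using ideals.subspace_0[OF I] ideals.subspace_neg[OF I] by (auto simp: mult.commute)
    qed
    fix d assume "cocycle I (?Z \<union> ?Y) (1 + card ?Y) d"
    then show "coboundary I (?Z \<union> ?Y) (1 + card ?Y) d"
      unfolding ZY using fs len by (intro koszul_vanishing[OF I, of fs]) (simp_all add: ideal_hull_pvar)
  qed (simp_all add: I)
  then obtain b where b: "\<And>L. L \<in> chains ?Z 1 \<Longrightarrow> c L - koszul b L \<in> ideal_hull (I \<union> ?Y)"
    unfolding coboundary_def by blast
  have hull: "ideal_hull (I \<union> ?Y) \<subseteq> var_ideal (D \<union> C)" if "I \<subseteq> var_ideal D" for D
  proof (rule ideals.span_minimal)
    show "I \<union> ?Y \<subseteq> var_ideal (D \<union> C)" using that var_ideal_mono[of D "D \<union> C"] by auto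
  qed simp
  have "c [pvar g] = pvar g" "c [pvar h] = 0" using g(1) h(1) disj(1) by (auto simp: c_def)
  then have gh: "pvar g * (1 - b []) \<in> ideal_hull (I \<union> ?Y)" "pvar h * (- b []) \<in> ideal_hull (I \<union> ?Y)"
    using b[of "[pvar g]"] b[of "[pvar h]"] g(1) h(1) by (simp_all add: chains_def right_diff_distrib)
  have "pvar g * (1 - b []) \<in> var_ideal (A \<union> C)" using gh(1) hull[OF g(3)] by blast
  moreover have "g \<notin> A \<union> C" using g disj by auto
  ultimately have "1 - b [] \<in> var_ideal (A \<union> C)" unfolding pvar_mult_in_var_ideal by blast
  then have 1: "lookup (b []) 0 = 1"
    using const_coeff_var_ideal by (force simp: lookup_minus)
  have "pvar h * (- b []) \<in> var_ideal (B \<union> C)" using gh(2) hull[OF h(3)] by blast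
  moreover have "h \<notin> B \<union> C" using h disj by auto
  ultimately have "- b [] \<in> var_ideal (B \<union> C)" unfolding pvar_mult_in_var_ideal by blast
  then have "lookup (b []) 0 = 0"
    using const_coeff_var_ideal by force
  then show False using 1 by simp
qed

section \<open>Complexes whose vertices lie in at most two facets\<close>

text \<open>
  The \<open>F i\<close> are the facets of a simplicial complex in which every vertex lies in at most two facets.
\<close>
locale sparse_facets =
  fixes N :: "'i set" and F :: "'i \<Rightarrow> 'n::finite set"
  assumes finite_N: "finite N"
    and antichain: "i \<in> N \<Longrightarrow> j \<in> N \<Longrightarrow> i \<noteq> j \<Longrightarrow> \<not> F i \<subseteq> F j"
    and triple: "i \<in> N \<Longrightarrow> j \<in> N \<Longrightarrow> k \<in> N \<Longrightarrow> i \<noteq> j \<Longrightarrow> i \<noteq> k \<Longrightarrow> j \<noteq> k \<Longrightarrow> F i \<inter> F j \<inter> F k = {}"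
begin

definition face_ideal :: "'i set \<Rightarrow> ('n, 'k::field) mpoly set" where
  "face_ideal T = (\<Inter>i\<in>T. var_ideal (- F i))"

text \<open>
  Connectedness of the graph that \<open>T\<close> spans, expressed by cuts, which is the form both for producing and for
  using it. A \<open>bridge\<close> is likewise an edge that is the only one across some cut.
\<close>
definition connected_on :: "'i set \<Rightarrow> bool" where
  "connected_on T \<longleftrightarrow> (\<forall>S. S \<noteq> {} \<and> S \<subset> T \<longrightarrow> (\<exists>i\<in>S. \<exists>j\<in>T - S. F i \<inter> F j \<noteq> {}))"

definition bridge :: "'i \<Rightarrow> 'i \<Rightarrow> bool" where
  "bridge i j \<longleftrightarrow> (\<exists>S\<subseteq>N. i \<in> S \<and> j \<in> N - S \<and>
     (\<forall>k\<in>S. \<forall>l\<in>N - S. F k \<inter> F l \<noteq> {} \<longrightarrow> k = i \<and> l = j))"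

lemma is_ideal_face_ideal [simp]: "is_ideal (face_ideal T :: ('n, 'k::field) mpoly set)"
  unfolding face_ideal_def by (intro ideals.subspace_Int) simp

lemma face_ideal_subset: "i \<in> T \<Longrightarrow> face_ideal T \<subseteq> var_ideal (- F i)"
  unfolding face_ideal_def by blast

lemma in_face_idealI: "(\<And>i. i \<in> T \<Longrightarrow> p \<in> var_ideal (- F i)) \<Longrightarrow> p \<in> face_ideal T"
  unfolding face_ideal_def by blast

text \<open>
  Outside \<open>C\<close>, no facet meets both the union of the facets in \<open>S\<close> and its complement, so \<open>C\<close> is a vertex cut.
\<close>
lemma regular_length_le_separation:
  fixes fs :: "('n, 'k::field) mpoly list"
  assumes fs: "regular_seq (face_ideal N) fs" "set fs \<subseteq> var_ideal UNIV"
    and S: "S \<subseteq> N" and C: "\<And>k l. k \<in> S \<Longrightarrow> l \<in> N - S \<Longrightarrow> F k \<inter> F l \<subseteq> C"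
    and i: "i \<in> S" "g \<in> F i - C" and j: "j \<in> N - S" "h \<in> F j - C"
  shows "length fs \<le> card C + 1"
proof -
  define V1 where "V1 = (\<Union>k\<in>S. F k) - C"
  have "(pvar u * pvar v :: ('n, 'k) mpoly) \<in> face_ideal N" if "u \<in> V1" "v \<in> - (V1 \<union> C)" for u v
  proof (rule in_face_idealI)
    fix k assume "k \<in> N"
    then have "u \<notin> F k \<or> v \<notin> F k" using that C unfolding V1_def by blast
    then show "(pvar u * pvar v :: ('n, 'k) mpoly) \<in> var_ideal (- F k)"
      by (simp add: pvar_mult_in_var_ideal)
  qed
  moreover have "g \<in> V1" using i by (auto simp: V1_def)
  moreover have "h \<in> - (V1 \<union> C)" using j C unfolding V1_def by blast
  ultimately show ?thesis
    using i j S
    by (intro regular_length_le_cut[OF is_ideal_face_ideal fs, of V1 "- (V1 \<union> C)" C g "- F i" h "- F j"]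
        face_ideal_subset) (auto simp: V1_def)
qed

lemma facet_diff: "i \<in> N \<Longrightarrow> j \<in> N \<Longrightarrow> i \<noteq> j \<Longrightarrow> \<exists>g. g \<in> F i - F i \<inter> F j"
  using antichain[of i j] by blast

lemma regular_length_le_bridge:
  fixes fs :: "('n, 'k::field) mpoly list"
  assumes fs: "regular_seq (face_ideal N) fs" "set fs \<subseteq> var_ideal UNIV" and "bridge i j"
  shows "length fs \<le> card (F i \<inter> F j) + 1"
proof -
  obtain S where S: "S \<subseteq> N" "i \<in> S" "j \<in> N - S"
      and cross: "\<And>k l. k \<in> S \<Longrightarrow> l \<in> N - S \<Longrightarrow> F k \<inter> F l \<noteq> {} \<Longrightarrow> k = i \<and> l = j"
    using assms(3) unfolding bridge_def by blast
  obtain g h where "g \<in> F i - F i \<inter> F j" "h \<in> F j - F i \<inter> F j"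
    using facet_diff[of i j] facet_diff[of j i] S by blast
  then show ?thesis
    using S cross by (intro regular_length_le_separation[OF fs S(1), of _ i g j h]) blast+
qed

text \<open>
  Consider, in degree 0, the element of \<open>\<Oplus> S/(P\<^sub>i + P\<^sub>j)\<close> over the edges which is 1 at \<open>ab\<close> and 0
  elsewhere. It is not the image of an element of \<open>\<Oplus> S/P\<^sub>i\<close>, as \<open>ab\<close> lies on a cycle, but
  its multiple by any variable is. The liftings \<open>u\<^sub>g\<close> can be taken to be \<open>x\<^sub>g\<close> in the component \<open>a\<close> if
  \<open>g \<in> F a \<inter> F b\<close>, and 0 otherwise. Then \<open>x\<^sub>g u\<^sub>h - x\<^sub>h u\<^sub>g\<close> lies in \<open>S/I\<close> and is a cocycle of degree 2; it is
  \<open>x\<^sub>g x\<^sub>h (t h - t g)\<close> for \<open>g, h \<in> F a\<close>, with \<open>t\<close> the indicator of \<open>F a \<inter> F b\<close>, and 0 otherwise.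
  
  If it were the coboundary of \<open>e\<close>, compare the coefficients of \<open>x\<^sub>g x\<^sub>h\<close>. They tell that the coefficient
  \<open>\<beta> g\<close> of \<open>x\<^sub>g\<close> in \<open>e [x\<^sub>g]\<close> is constant on each facet other than \<open>F a\<close>, and that \<open>\<beta> - t\<close> is constant on
  \<open>F a\<close>. The facets on which this constant is the same as on \<open>F a\<close> can only be left through the edge \<open>ab\<close>,
  so \<open>ab\<close> is a bridge.
\<close>
lemma regular_length_le_non_bridge:
  fixes fs :: "('n, 'k::field) mpoly list"
  assumes fs: "regular_seq (face_ideal N) fs" "set fs \<subseteq> var_ideal UNIV"
    and a: "a \<in> N" and b: "b \<in> N" and ab: "a \<noteq> b" "F a \<inter> F b \<noteq> {}" and nb: "\<not> bridge a b"
  shows "length fs \<le> 2"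
proof (rule ccontr)
  assume "\<not> length fs \<le> 2"
  then have len: "2 < length fs" by simp
  define C where "C = F a \<inter> F b"
  define t :: "('n, 'k) mpoly \<Rightarrow> ('n, 'k) mpoly" where "t x = (if x \<in> pvar ` C then 1 else 0)" for x
  define c :: "('n, 'k) mpoly list \<Rightarrow> ('n, 'k) mpoly"
    where "c L = (if set L \<subseteq> pvar ` F a then hd L * (L ! 1 * (t (L ! 1) - t (hd L))) else 0)" for L
  let ?I = "face_ideal N :: ('n, 'k) mpoly set"
  have only: "i = a \<or> i = b" if "i \<in> N" "v \<in> F i" "v \<in> C" for i v
    using triple[OF that(1) a b] that ab by (auto simp: C_def)
  \<comment> \<open>If \<open>u\<close> and \<open>v\<close> are in one facet and one of them is in \<open>C\<close>, the other in
         \<open>F a - C\<close>, then this facet is \<open>F a\<close>, which does not contain \<open>w\<close>.\<close>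
  have key: "(pvar w * (pvar u * (pvar v * (t (pvar v) - t (pvar u))))) \<in> ?I"
    if "u \<in> F a" "v \<in> F a" "w \<notin> F a" for u v w
  proof (rule in_face_idealI)
    fix i assume i: "i \<in> N"
    show "(pvar w * (pvar u * (pvar v * (t (pvar v) - t (pvar u))))) \<in> (var_ideal (- F i) :: ('n, 'k) mpoly set)"
    proof (cases "u \<in> C \<longleftrightarrow> v \<in> C")
      case True
      then show ?thesis by (simp add: t_def ideals.subspace_0[OF is_ideal_var_ideal])
    next
      case False
      then have "u \<notin> F i \<or> v \<notin> F i \<or> w \<notin> F i"
        using only[OF i, of u] only[OF i, of v] that by (auto simp: C_def)
      then show ?thesis
        by (auto simp: pvar_mult_in_var_ideal)
    qed
  qed
  have c2: "c [pvar u, pvar v] = (if u \<in> F a \<and> v \<in> F a then pvar u * (pvar v * (t (pvar v) - t (pvar u))) else 0)" for u v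
    by (simp add: c_def)
  have "coboundary ?I (range pvar) 2 c"
  proof (rule koszul_vanishing[OF is_ideal_face_ideal fs(1) _ len])
    show "set fs \<subseteq> ideal_hull (range pvar)" using fs(2) by (simp add: ideal_hull_pvar)
    show "cocycle ?I (range pvar) 2 c"
      unfolding cocycle_def
    proof
      fix L :: "('n, 'k) mpoly list" assume "L \<in> chains (range pvar) (Suc 2)"
      then obtain u v w where L: "L = [pvar u, pvar v, pvar w]"
        by (auto simp: chains_def numeral_2_eq_2 length_Suc_conv)
      have eq: "koszul c L = pvar u * c [pvar v, pvar w] - (pvar v * c [pvar u, pvar w] - pvar w * c [pvar u, pvar v])"
        by (simp add: L)
      consider "u \<in> F a" "v \<in> F a" "w \<in> F a" | "u \<notin> F a" "v \<in> F a" "w \<in> F a"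
        | "u \<in> F a" "v \<notin> F a" "w \<in> F a" | "u \<in> F a" "v \<in> F a" "w \<notin> F a"
        | "u \<notin> F a \<and> v \<notin> F a \<or> u \<notin> F a \<and> w \<notin> F a \<or> v \<notin> F a \<and> w \<notin> F a"
        by blast
      then show "koszul c L \<in> ?I"
      proof cases
        case 1
        then have "koszul c L = 0" unfolding eq c2 by (simp add: algebra_simps)
        then show ?thesis by (simp add: ideals.subspace_0[OF is_ideal_face_ideal])
      next
        case 2
        then show ?thesis using key[of v w u] unfolding eq c2 by simp
      next
        case 3
        then show ?thesis using ideals.subspace_neg[OF is_ideal_face_ideal key[of u w v]] unfolding eq c2 by simp
      next
        case 4
        then show ?thesis using key[of u v w] unfolding eq c2 by simp
      next
        case 5
        then have "koszul c L = 0" unfolding eq c2 by auto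
        then show ?thesis by (simp add: ideals.subspace_0[OF is_ideal_face_ideal])
      qed
    qed
  qed
  then obtain e where e: "\<And>L. L \<in> chains (range pvar) 2 \<Longrightarrow> c L - koszul e L \<in> ?I"
    unfolding coboundary_def by blast
  define \<beta> where "\<beta> v = lookup (e [pvar v]) (Poly_Mapping.single v 1)" for v
  define \<tau> :: "'n \<Rightarrow> 'k" where "\<tau> v = (if v \<in> C then 1 else 0)" for v
  have diff: "\<beta> v - \<beta> u = (if u \<in> F a \<and> v \<in> F a then \<tau> v - \<tau> u else 0)"
    if i: "i \<in> N" and uv: "u \<in> F i" "v \<in> F i" for i u v
  proof -
    let ?m = "Poly_Mapping.single u 1 + Poly_Mapping.single v (1::nat)"
    have "c [pvar u, pvar v] - (pvar u * e [pvar v] - pvar v * e [pvar u]) \<in> ?I"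
      using e[of "[pvar u, pvar v]"] by (simp add: chains_def)
    then have "c [pvar u, pvar v] - (pvar u * e [pvar v] - pvar v * e [pvar u]) \<in> var_ideal (- F i)"
      using face_ideal_subset[OF i] by blast
    moreover have "\<not> (\<exists>x\<in>- F i. lookup ?m x \<noteq> 0)"
      using uv by (auto simp: lookup_add lookup_single when_def)
    ultimately have "?m \<notin> keys (c [pvar u, pvar v] - (pvar u * e [pvar v] - pvar v * e [pvar u]))"
      unfolding var_ideal_def by blast
    then have "lookup (c [pvar u, pvar v]) ?m = lookup (pvar u * e [pvar v]) ?m - lookup (pvar v * e [pvar u]) ?m"
      by (simp add: in_keys_iff lookup_minus)
    also have "lookup (pvar u * e [pvar v]) ?m = \<beta> v"
      unfolding \<beta>_def by (rule lookup_pvar_mult)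
    also have "lookup (pvar v * e [pvar u]) ?m = \<beta> u"
      unfolding \<beta>_def by (subst add.commute) (rule lookup_pvar_mult)
    also have "lookup (c [pvar u, pvar v]) ?m = (if u \<in> F a \<and> v \<in> F a then \<tau> v - \<tau> u else 0)"
    proof -
      have "lookup (pvar u * (pvar v * p)) ?m = lookup p 0" for p :: "('n, 'k) mpoly"
        using lookup_pvar_mult[of u "pvar v * p" "Poly_Mapping.single v 1"] lookup_pvar_mult[of v p 0] by simp
      then show ?thesis by (simp add: c2 t_def \<tau>_def lookup_minus)
    qed
    finally show ?thesis by simp
  qed
  obtain g0 where g0: "g0 \<in> C" using ab by (auto simp: C_def)
  define \<kappa> where "\<kappa> = \<beta> g0 - 1"
  define S where "S = {i \<in> N. \<forall>g\<in>F i. \<beta> g = \<kappa> + (if i = a then \<tau> g else 0)}"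
  have const: "\<beta> u = \<beta> v" if "i \<in> N" "i \<noteq> a" "u \<in> F i" "v \<in> F i" for i u v
  proof -
    have "\<tau> u = \<tau> v" if "u \<in> F a" "v \<in> F a"
      using only[OF \<open>i \<in> N\<close>, of u] only[OF \<open>i \<in> N\<close>, of v] \<open>i \<noteq> a\<close> \<open>u \<in> F i\<close> \<open>v \<in> F i\<close> that
      by (auto simp: \<tau>_def C_def)
    then show ?thesis using diff[OF that(1,4,3)] by (auto split: if_splits)
  qed
  have "a \<in> S"
    using a g0 diff[OF a, of g0] by (auto simp: S_def \<kappa>_def C_def \<tau>_def algebra_simps)
  have "b \<notin> S"
  proof
    assume "b \<in> S"
    then have "\<beta> g0 = \<kappa>" using g0 ab by (simp add: S_def C_def)
    then show False by (simp add: \<kappa>_def)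
  qed
  moreover have "\<forall>k\<in>S. \<forall>l\<in>N - S. F k \<inter> F l \<noteq> {} \<longrightarrow> k = a \<and> l = b"
  proof (intro ballI impI, rule ccontr)
    fix k l assume k: "k \<in> S" and l: "l \<in> N - S" and "F k \<inter> F l \<noteq> {}" and kl: "\<not> (k = a \<and> l = b)"
    then obtain g where g: "g \<in> F k" "g \<in> F l" by blast
    have la: "l \<noteq> a" using l \<open>a \<in> S\<close> by blast
    have "\<tau> g = 0" if "k = a"
      using that kl la g only[of l g] l by (auto simp: \<tau>_def)
    then have "\<beta> g = \<kappa>" using k g by (auto simp: S_def)
    then have "\<forall>u\<in>F l. \<beta> u = \<kappa>" using const[of l _ g] l la g by auto
    then show False using l la by (auto simp: S_def)
  qed
  moreover have "S \<subseteq> N" unfolding S_def by blast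
  ultimately have "bridge a b"
    unfolding bridge_def using \<open>a \<in> S\<close> b by blast
  then show False using nb by contradiction
qed

lemma connected_onE:
  assumes "connected_on T" "S \<noteq> {}" "S \<subset> T"
  obtains i j where "i \<in> S" "j \<in> T - S" "F i \<inter> F j \<noteq> {}"
  using assms(1)[unfolded connected_on_def, rule_format, of S] assms(2,3) by (auto elim!: bexE)

lemma connected_on_insert:
  assumes "connected_on T" "i \<in> T" "F i \<inter> F k \<noteq> {}" "k \<notin> T"
  shows "connected_on (insert k T)"
  unfolding connected_on_def
proof (intro allI impI)
  fix S assume S: "S \<noteq> {} \<and> S \<subset> insert k T"
  consider "S = {k}" | "S = T" | "S \<inter> T \<noteq> {}" "S \<inter> T \<subset> T" using S by blast
  then show "\<exists>i\<in>S. \<exists>j\<in>insert k T - S. F i \<inter> F j \<noteq> {}"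
  proof cases
    case 1
    then show ?thesis using assms(2-4) by (intro bexI[of _ k] bexI[of _ i]) (simp_all add: Int_commute)
  next
    case 2
    then show ?thesis using assms(2-4) by (intro bexI[of _ i] bexI[of _ k]) simp_all
  next
    case 3
    then obtain x y where "x \<in> S \<inter> T" "y \<in> T - S \<inter> T" "F x \<inter> F y \<noteq> {}"
      by (rule connected_onE[OF assms(1)])
    then show ?thesis by blast
  qed
qed

text \<open>
  Two neighbours of \<open>k\<close> in a connected set would give a cycle through \<open>k\<close>.
\<close>
lemma bridges_unique_neighbour:
  assumes bridges: "\<And>i j. i \<in> N \<Longrightarrow> j \<in> N \<Longrightarrow> i \<noteq> j \<Longrightarrow> F i \<inter> F j \<noteq> {} \<Longrightarrow> bridge i j"
    and T: "T \<subseteq> N" "connected_on T" and k: "k \<in> N - T"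
    and i: "i \<in> T" "F i \<inter> F k \<noteq> {}" and j: "j \<in> T" "F j \<inter> F k \<noteq> {}"
  shows "i = j"
proof (rule ccontr)
  assume "i \<noteq> j"
  have "bridge i k" using bridges[of i k] T k i by auto
  then obtain U where U: "U \<subseteq> N" "i \<in> U" "k \<in> N - U"
      and cross: "\<And>x y. x \<in> U \<Longrightarrow> y \<in> N - U \<Longrightarrow> F x \<inter> F y \<noteq> {} \<Longrightarrow> x = i \<and> y = k"
    unfolding bridge_def by blast
  have "j \<notin> U" using cross[of j k] U j \<open>i \<noteq> j\<close> by blast
  then have "T \<inter> U \<noteq> {}" "T \<inter> U \<subset> T" using i j U by auto
  then obtain x y where xy: "x \<in> T \<inter> U" "y \<in> T - T \<inter> U" "F x \<inter> F y \<noteq> {}"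
    by (rule connected_onE[OF T(2)])
  then show False using cross[of x y] T k by blast
qed

text \<open>
  Facets are added one at a time, along edges. When \<open>k\<close> joins \<open>T\<close>, the sum of \<open>face_ideal T\<close> and the ideal
  of \<open>F k\<close> is the intersection of the ideals of \<open>F j \<inter> F k\<close> for the neighbours \<open>j\<close> of \<open>k\<close> in \<open>T\<close>. The colour
  sums are regular on it if there is only one neighbour, as for bridges, or if there is only one colour,
  since a single nonzerodivisor modulo several ideals is one modulo their intersection.
\<close>
lemma regular_face_ideal:
  fixes \<chi> :: "'n \<Rightarrow> nat"
  assumes \<chi>: "\<And>v. \<chi> v < r"
    and colours: "\<And>i j c. i \<in> N \<Longrightarrow> j \<in> N \<Longrightarrow> i \<noteq> j \<Longrightarrow> F i \<inter> F j \<noteq> {} \<Longrightarrow> c < r \<Longrightarrow> \<exists>v\<in>F i \<inter> F j. \<chi> v = c"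
    and conn: "connected_on N" and N: "2 \<le> card N"
    and r: "r = 1 \<or> (\<forall>i\<in>N. \<forall>j\<in>N. i \<noteq> j \<longrightarrow> F i \<inter> F j \<noteq> {} \<longrightarrow> bridge i j)"
  shows "regular_seq (face_ideal N :: ('n, 'k::field) mpoly set) (map (colour_sum \<chi>) [0..<r] @ [pair_sum])"
proof -
  let ?fs = "map (colour_sum \<chi>) [0..<r] :: ('n, 'k) mpoly list"
  have single: "regular_seq (var_ideal (- F i)) (?fs @ [pair_sum])" if i: "i \<in> N" for i
  proof -
    have "{i} \<subset> N" using i N by (auto simp: psubset_eq)
    then obtain i' j where "i' \<in> {i}" "j \<in> N - {i}" "F i' \<inter> F j \<noteq> {}"
      by (rule connected_onE[OF conn insert_not_empty])
    then have j: "j \<in> N" "i \<noteq> j" "F i \<inter> F j \<noteq> {}" by auto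
    obtain v where v: "v \<in> F i" "v \<notin> F j" using antichain[OF i j(1,2)] by blast
    \<comment> \<open>The colours are already exhausted on \<open>F i \<inter> F j\<close>, so a further vertex of \<open>F i\<close> repeats one.\<close>
    obtain u where u: "u \<in> F i \<inter> F j" "\<chi> u = \<chi> v" using colours[OF i j \<chi>] by blast
    show ?thesis
    proof (rule regular_colour_sums_pair_sum[where u = u and v = v])
      show "\<exists>w. w \<notin> - F i \<and> \<chi> w = c" if "c < r" for c using colours[OF i j that] by blast
    qed (use u v in auto)
  qed
  have "\<exists>T\<subseteq>N. card T = Suc m \<and> connected_on T \<and> regular_seq (face_ideal T) (?fs @ [pair_sum])"
    if "Suc m \<le> card N" for m
    using that
  proof (induction m)
    case 0
    then obtain i where i: "i \<in> N" by (metis One_nat_def card.empty ex_in_conv not_one_le_zero)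
    show ?case
      using i single[OF i] by (intro exI[of _ "{i}"]) (auto simp: connected_on_def face_ideal_def)
  next
    case (Suc m)
    then obtain T where T: "T \<subseteq> N" "card T = Suc m" "connected_on T"
        "regular_seq (face_ideal T) (?fs @ [pair_sum])" by auto
    have "T \<noteq> {}" "T \<subset> N" using T(1,2) Suc.prems by auto
    then obtain i k where ik: "i \<in> T" "k \<in> N - T" "F i \<inter> F k \<noteq> {}"
      by (rule connected_onE[OF conn])
    define B where "B = {j \<in> T. F j \<inter> F k \<noteq> {}}"
    have B: "regular_seq (var_ideal (- F j \<union> - F k)) ?fs" if "j \<in> B" for j
    proof (rule regular_colour_sums)
      fix c assume "c < r"
      then show "\<exists>v. v \<notin> - F j \<union> - F k \<and> \<chi> v = c"
        using colours[of j k c] that T(1) ik(2) by (auto simp: B_def)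
    qed
    have iB: "i \<in> B" using ik by (simp add: B_def)
    have "ideal_hull (face_ideal T \<union> var_ideal (- F k)) = (\<Inter>j\<in>T. var_ideal (- F j \<union> - F k) :: ('n, 'k) mpoly set)"
      unfolding face_ideal_def by (rule ideal_hull_Inter_Un_var_ideal)
    \<comment> \<open>For a nonneighbour \<open>j\<close> the ideal is that of all variables, which contains the others.\<close>
    also have "\<dots> = (\<Inter>j\<in>B. var_ideal (- F j \<union> - F k))"
    proof
      have top: "var_ideal (- F j \<union> - F k) = (var_ideal UNIV :: ('n, 'k) mpoly set)" if "j \<in> T - B" for j
      proof -
        have "- F j \<union> - F k = UNIV" using that by (auto simp: B_def)
        then show ?thesis by simp
      qed
      show "(\<Inter>j\<in>B. var_ideal (- F j \<union> - F k)) \<subseteq> (\<Inter>j\<in>T. var_ideal (- F j \<union> - F k) :: ('n, 'k) mpoly set)"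
      proof
        fix p :: "('n, 'k) mpoly" assume p: "p \<in> (\<Inter>j\<in>B. var_ideal (- F j \<union> - F k))"
        then have "p \<in> var_ideal UNIV" using iB var_ideal_mono[OF subset_UNIV] by blast
        then show "p \<in> (\<Inter>j\<in>T. var_ideal (- F j \<union> - F k))" using p top by blast
      qed
    qed (auto simp: B_def)
    also have "regular_seq \<dots> ?fs"
      using r
    proof
      assume "r = 1"
      then show ?thesis using B by auto
    next
      assume bridges: "\<forall>i\<in>N. \<forall>j\<in>N. i \<noteq> j \<longrightarrow> F i \<inter> F j \<noteq> {} \<longrightarrow> bridge i j"
      have "B = {i}"
        using bridges_unique_neighbour[OF _ T(1,3) ik(2), of i] bridges ik iB unfolding B_def by blast
      then show ?thesis using B[OF iB] by simp
    qed
    finally have "regular_seq (face_ideal T \<inter> var_ideal (- F k)) (?fs @ [pair_sum])"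
      using T(4) single[of k] ik(2) by (intro regular_inter) auto
    moreover have "face_ideal (insert k T) = (face_ideal T \<inter> var_ideal (- F k) :: ('n, 'k) mpoly set)"
      by (auto simp: face_ideal_def)
    moreover have "card (insert k T) = Suc (Suc m)"
      using T ik(2) finite_subset[OF T(1) finite_N] by simp
    moreover have "connected_on (insert k T)" using ik by (intro connected_on_insert[OF T(3)]) auto
    ultimately show ?case using T(1) ik(2) by (intro exI[of _ "insert k T"]) auto
  qed
  from this[of "card N - 1"] show ?thesis
    using N card_subset_eq[OF finite_N] by auto
qed

end

text \<open>
  Each block is enumerated, and the enumeration is cut off at \<open>r\<close>.
\<close>
lemma ex_colouring:
  fixes \<C> :: "'n::finite set set"
  assumes card: "\<And>C. C \<in> \<C> \<Longrightarrow> r \<le> card C" and r: "1 \<le> r"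
    and disj: "\<And>C D. C \<in> \<C> \<Longrightarrow> D \<in> \<C> \<Longrightarrow> C \<inter> D \<noteq> {} \<Longrightarrow> C = D"
  shows "\<exists>\<chi>. (\<forall>v. \<chi> v < r) \<and> (\<forall>C\<in>\<C>. \<forall>c<r. \<exists>v\<in>C. \<chi> v = c)"
proof -
  define h where "h C = (SOME f. bij_betw f C {0..<card C})" for C :: "'n set"
  have h: "bij_betw (h C) C {0..<card C}" for C :: "'n set"
    unfolding h_def by (rule someI_ex[OF ex_bij_betw_finite_nat[OF finite]])
  define block where "block v = (SOME C. C \<in> \<C> \<and> v \<in> C)" for v
  have block: "block v = C" if "C \<in> \<C>" "v \<in> C" for C v
  proof -
    have "block v \<in> \<C> \<and> v \<in> block v" unfolding block_def using that by (rule someI[of _ C, OF conjI])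
    then show ?thesis using disj[of "block v" C] that by blast
  qed
  define \<chi> where "\<chi> v = (if h (block v) v < r then h (block v) v else 0)" for v
  have "\<exists>v\<in>C. \<chi> v = c" if C: "C \<in> \<C>" and c: "c < r" for C c
  proof -
    have "c \<in> {0..<card C}" using card[OF C] c by simp
    then obtain v where "v \<in> C" "h C v = c" using bij_betw_imp_surj_on[OF h[of C]] by (elim equalityE) (auto simp: subset_iff image_iff)
    then show ?thesis using block[OF C] c by (intro bexI[of _ v]) (auto simp: \<chi>_def)
  qed
  moreover have "\<chi> v < r" for v using r by (auto simp: \<chi>_def)
  ultimately show ?thesis by blast
qed

section \<open>Depth of the face ring\<close>

lemma vars_ideal_eq: "vars_ideal = (var_ideal UNIV :: ('n::finite, 'k::field) mpoly set)"
  unfolding vars_ideal_def by (rule genideal_mpoly)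

lemma colour_sum_in_vars: "colour_sum \<chi> j \<in> (var_ideal UNIV :: ('n::finite, 'k::field) mpoly set)"
  unfolding colour_sum_def by (intro ideals.subspace_sum) auto

lemma pair_sum_in_vars: "pair_sum \<in> (var_ideal UNIV :: ('n::finite, 'k::field) mpoly set)"
  unfolding pair_sum_def
proof (rule ideals.subspace_sum[OF is_ideal_var_ideal])
  fix T :: "'n set" assume "T \<in> {T. card T = 2}"
  then have "T \<noteq> {}" by auto
  then obtain v where "v \<in> T" by blast
  then have "(\<Prod>v\<in>T. pvar v) = (pvar v * (\<Prod>u\<in>T - {v}. pvar u) :: ('n, 'k) mpoly)"
    by (intro prod.remove) auto
  then show "(\<Prod>v\<in>T. pvar v) \<in> (var_ideal UNIV :: ('n, 'k) mpoly set)"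
    by (simp add: pvar_mult_in_var_ideal)
qed

context sparse_facets
begin

abbreviation face_depth :: "'k::field itself \<Rightarrow> enat" where
  "face_depth _ \<equiv> depth mpoly_ring vars_ideal (quot_module mpoly_ring (face_ideal N :: ('n, 'k) mpoly set))"

lemma depth_face_idealI:
  fixes fs :: "('n, 'k::field) mpoly list"
  assumes "N \<noteq> {}" "regular_seq (face_ideal N) fs" "set fs \<subseteq> var_ideal UNIV"
    and "\<And>gs :: ('n, 'k) mpoly list. regular_seq (face_ideal N) gs \<Longrightarrow> set gs \<subseteq> var_ideal UNIV \<Longrightarrow> length gs \<le> length fs"
  shows "face_depth TYPE('k) = enat (length fs)"
  unfolding vars_ideal_eq mpoly_ring_def
proof (rule depth_quot_eqI)
  show "(var_ideal UNIV :: ('n, 'k) mpoly set) \<noteq> UNIV" using one_notin_var_ideal by blast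
  obtain i where "i \<in> N" using assms(1) by blast
  then have "face_ideal N \<subseteq> (var_ideal (- F i) :: ('n, 'k) mpoly set)" by (rule face_ideal_subset)
  then show "face_ideal N \<subseteq> (var_ideal UNIV :: ('n, 'k) mpoly set)"
    using var_ideal_mono[of "- F i" UNIV] by blast
qed (use assms in auto)

lemma depth_disconnected:
  assumes "\<not> connected_on N"
  shows "face_depth TYPE('k::field) = 1"
proof -
  obtain S where S: "S \<noteq> {}" "S \<subset> N" "\<And>i j. i \<in> S \<Longrightarrow> j \<in> N - S \<Longrightarrow> F i \<inter> F j = {}"
    using assms unfolding connected_on_def by blast
  obtain i j where ij: "i \<in> S" "j \<in> N - S" using S(1,2) by blast
  have "i \<in> N" "j \<in> N" "i \<noteq> j" using ij S(2) by auto
  then obtain g h where gh: "g \<in> F i - {}" "h \<in> F j - {}"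
    using facet_diff[of i j] facet_diff[of j i] by blast
  let ?f = "colour_sum (\<lambda>_. 0) 0 :: ('n, 'k) mpoly"
  have "face_depth TYPE('k) = enat (length [?f])"
  proof (rule depth_face_idealI)
    show "N \<noteq> {}" using \<open>i \<in> N\<close> by blast
    have facet: "regular_seq (var_ideal (- F k)) [?f]" if k: "k \<in> N" for k
    proof -
      obtain l where "l \<in> N" "k \<noteq> l" using \<open>i \<in> N\<close> \<open>j \<in> N\<close> \<open>i \<noteq> j\<close> by blast
      then obtain v where "v \<in> F k" using facet_diff[OF k] by blast
      then show ?thesis using regular_colour_sums[of 1 "- F k" "\<lambda>_. 0"] by auto
    qed
    then show "regular_seq (face_ideal N) [?f]" by (auto simp: face_ideal_def)
    show "set [?f] \<subseteq> var_ideal UNIV" using colour_sum_in_vars by simp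
    fix gs :: "('n, 'k) mpoly list" assume gs: "regular_seq (face_ideal N) gs" "set gs \<subseteq> var_ideal UNIV"
    have "length gs \<le> card ({} :: 'n set) + 1"
      by (rule regular_length_le_separation[OF gs psubset_imp_subset[OF S(2)] _ ij(1) gh(1) ij(2) gh(2)])
        (simp add: S(3))
    then show "length gs \<le> length [?f]" by simp
  qed
  then show ?thesis by (simp add: one_enat_def)
qed

lemma depth_non_bridge:
  assumes "connected_on N" and ab: "a \<in> N" "b \<in> N" "a \<noteq> b" "F a \<inter> F b \<noteq> {}" "\<not> bridge a b"
  shows "face_depth TYPE('k::field) = 2"
proof -
  let ?fs = "map (colour_sum (\<lambda>_. 0)) [0..<1] @ [pair_sum] :: ('n, 'k) mpoly list"
  have "card {a, b} \<le> card N" using ab finite_N by (intro card_mono) auto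
  then have N: "2 \<le> card N" using ab(3) by simp
  have "face_depth TYPE('k) = enat (length ?fs)"
  proof (rule depth_face_idealI)
    show "N \<noteq> {}" using ab(1) by blast
    show "regular_seq (face_ideal N) ?fs" using assms(1) N by (intro regular_face_ideal) auto
    show "set ?fs \<subseteq> var_ideal UNIV" using colour_sum_in_vars pair_sum_in_vars by auto
    fix gs :: "('n, 'k) mpoly list" assume gs: "regular_seq (face_ideal N) gs" "set gs \<subseteq> var_ideal UNIV"
    show "length gs \<le> length ?fs" using regular_length_le_non_bridge[OF gs ab] by simp
  qed
  then show ?thesis by (simp add: numeral_eq_enat)
qed

text \<open>
  The intersections of adjacent facets are pairwise disjoint, as no vertex lies in three facets, so they can
  be coloured independently with as many colours as the smallest of them has elements.
\<close>
lemma depth_tree: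
  assumes "connected_on N" and ab: "a \<in> N" "b \<in> N" "a \<noteq> b" "F a \<inter> F b \<noteq> {}"
    and min: "\<And>i j. i \<in> N \<Longrightarrow> j \<in> N \<Longrightarrow> i \<noteq> j \<Longrightarrow> F i \<inter> F j \<noteq> {} \<Longrightarrow> card (F a \<inter> F b) \<le> card (F i \<inter> F j)"
    and bridges: "\<And>i j. i \<in> N \<Longrightarrow> j \<in> N \<Longrightarrow> i \<noteq> j \<Longrightarrow> F i \<inter> F j \<noteq> {} \<Longrightarrow> bridge i j"
  shows "face_depth TYPE('k::field) = enat (card (F a \<inter> F b) + 1)"
proof -
  define r where "r = card (F a \<inter> F b)"
  define \<C> where "\<C> = {F i \<inter> F j | i j. i \<in> N \<and> j \<in> N \<and> i \<noteq> j \<and> F i \<inter> F j \<noteq> {}}"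
  have "\<exists>\<chi>. (\<forall>v. \<chi> v < r) \<and> (\<forall>C\<in>\<C>. \<forall>c<r. \<exists>v\<in>C. \<chi> v = c)"
  proof (rule ex_colouring)
    show "r \<le> card C" if "C \<in> \<C>" for C
    proof -
      obtain i j where "C = F i \<inter> F j" "i \<in> N" "j \<in> N" "i \<noteq> j" "F i \<inter> F j \<noteq> {}"
        using \<open>C \<in> \<C>\<close> unfolding \<C>_def by blast
      then show ?thesis using min[of i j] by (simp add: r_def)
    qed
    show "1 \<le> r" using ab(4) by (simp add: r_def Suc_le_eq card_gt_0_iff)
    show "C = D" if CD: "C \<in> \<C>" "D \<in> \<C>" "C \<inter> D \<noteq> {}" for C D
    proof -
      obtain i j where C: "C = F i \<inter> F j" "i \<in> N" "j \<in> N" "i \<noteq> j"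
        using \<open>C \<in> \<C>\<close> unfolding \<C>_def by blast
      obtain k l where D: "D = F k \<inter> F l" "k \<in> N" "l \<in> N" "k \<noteq> l"
        using \<open>D \<in> \<C>\<close> unfolding \<C>_def by blast
      obtain v where v: "v \<in> F i" "v \<in> F j" "v \<in> F k" "v \<in> F l" using CD(3) C D by blast
      have "k = i \<or> k = j" "l = i \<or> l = j"
        using triple[OF C(2,3) D(2) C(4)] triple[OF C(2,3) D(3) C(4)] v by auto
      then show ?thesis using C(1) D(1,4) by (auto simp: Int_commute)
    qed
  qed
  then obtain \<chi> where "(\<forall>v. \<chi> v < r) \<and> (\<forall>C\<in>\<C>. \<forall>c<r. \<exists>v\<in>C. \<chi> v = c)"
    by (elim exE)
  then have \<chi>: "\<And>v. \<chi> v < r" "\<And>C c. C \<in> \<C> \<Longrightarrow> c < r \<Longrightarrow> \<exists>v\<in>C. \<chi> v = c"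
    by simp_all
  let ?fs = "map (colour_sum \<chi>) [0..<r] @ [pair_sum] :: ('n, 'k) mpoly list"
  have "card {a, b} \<le> card N" using ab finite_N by (intro card_mono) auto
  then have N: "2 \<le> card N" using ab(3) by simp
  have "face_depth TYPE('k) = enat (length ?fs)"
  proof (rule depth_face_idealI)
    show "N \<noteq> {}" using ab(1) by blast
    show "regular_seq (face_ideal N) ?fs"
    proof (rule regular_face_ideal[OF \<chi>(1) _ assms(1) N])
      show "\<exists>v\<in>F i \<inter> F j. \<chi> v = c" if "i \<in> N" "j \<in> N" "i \<noteq> j" "F i \<inter> F j \<noteq> {}" "c < r" for i j c
      proof (rule \<chi>(2)[OF _ that(5)])
        show "F i \<inter> F j \<in> \<C>" unfolding \<C>_def using that by blast
      qed
      show "r = 1 \<or> (\<forall>i\<in>N. \<forall>j\<in>N. i \<noteq> j \<longrightarrow> F i \<inter> F j \<noteq> {} \<longrightarrow> bridge i j)"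
        using bridges by simp
    qed
    show "set ?fs \<subseteq> var_ideal UNIV" using colour_sum_in_vars pair_sum_in_vars by auto
    fix gs :: "('n, 'k) mpoly list" assume gs: "regular_seq (face_ideal N) gs" "set gs \<subseteq> var_ideal UNIV"
    show "length gs \<le> length ?fs"
      using regular_length_le_bridge[OF gs bridges[OF ab]] by (simp add: r_def)
  qed
  then show ?thesis by (simp add: r_def)
qed

end

lemma ex_renumbering_iff:
  fixes Q :: "nat \<Rightarrow> nat \<Rightarrow> bool"
  shows "(\<exists>\<pi> c. bij_betw \<pi> {1..s} {1..s} \<and> 1 \<le> c \<and> c < s \<and>
           (\<forall>i j. 1 \<le> i \<and> i \<le> c \<and> c < j \<and> j \<le> s \<longrightarrow> Q (\<pi> i) (\<pi> j))) \<longleftrightarrow>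
         (\<exists>S. S \<noteq> {} \<and> S \<subset> {1..s} \<and> (\<forall>i\<in>S. \<forall>j\<in>{1..s} - S. Q i j))" (is "?L \<longleftrightarrow> ?R")
proof
  assume ?L
  then obtain \<pi> c where \<pi>: "bij_betw \<pi> {1..s} {1..s}" and c: "1 \<le> c" "c < s"
    and Q: "\<And>i j. 1 \<le> i \<Longrightarrow> i \<le> c \<Longrightarrow> c < j \<Longrightarrow> j \<le> s \<Longrightarrow> Q (\<pi> i) (\<pi> j)" by blast
  have img: "\<pi> ` {1..s} = {1..s}" using \<pi> by (rule bij_betw_imp_surj_on)
  have inj: "inj_on \<pi> {1..s}" using \<pi> by (rule bij_betw_imp_inj_on)
  have "\<pi> s \<notin> \<pi> ` {1..c}"
    using c inj_on_image_mem_iff[OF inj, of s "{1..c}"] by auto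
  moreover have "\<pi> s \<in> {1..s}" using c img by auto
  moreover have "\<pi> ` {1..c} \<subseteq> {1..s}" using c img by auto
  ultimately have "\<pi> ` {1..c} \<subset> {1..s}" by blast
  moreover have "Q i j" if i: "i \<in> \<pi> ` {1..c}" and j: "j \<in> {1..s} - \<pi> ` {1..c}" for i j
  proof -
    obtain x where x: "x \<in> {1..c}" "i = \<pi> x" using i by blast
    have "j \<in> \<pi> ` {1..s}" using j img by simp
    then obtain y where y: "y \<in> {1..s}" "j = \<pi> y" by blast
    then have "c < y" using j by (metis DiffD2 atLeastAtMost_iff imageI not_le)
    then show ?thesis using Q[of x y] x y by simp
  qed
  moreover have "\<pi> ` {1..c} \<noteq> {}" using c by simp
  ultimately show ?R by (intro exI[of _ "\<pi> ` {1..c}"] conjI ballI)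
next
  assume ?R
  then obtain S where S: "S \<noteq> {}" "S \<subset> {1..s}" and Q: "\<And>i j. i \<in> S \<Longrightarrow> j \<in> {1..s} - S \<Longrightarrow> Q i j" by blast
  define c where "c = card S"
  have fin: "finite S" using S(2) finite_subset by blast
  have c: "1 \<le> c" "c < s"
    using S fin psubset_card_mono[OF _ S(2)] by (auto simp: c_def Suc_le_eq card_gt_0_iff)
  have "card ({1..s} - S) = card {c+1..s}"
    using S(2) fin c by (subst card_Diff_subset) (auto simp: c_def)
  then obtain g where g: "bij_betw g {c+1..s} ({1..s} - S)"
    by (metis finite_same_card_bij finite_Diff finite_atLeastAtMost)
  have "card {1..c} = card S" by (simp add: c_def)
  then obtain f where f: "bij_betw f {1..c} S"
    using finite_same_card_bij[OF _ fin] by blast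
  let ?\<pi> = "\<lambda>i. if i \<in> {1..c} then f i else g i"
  have "bij_betw ?\<pi> ({1..c} \<union> {c+1..s}) (S \<union> ({1..s} - S))"
  proof (rule bij_betw_combine)
    show "bij_betw ?\<pi> {1..c} S" using f by (subst bij_betw_cong[of _ _ f]) auto
    show "bij_betw ?\<pi> {c+1..s} ({1..s} - S)" using g by (subst bij_betw_cong[of _ _ g]) auto
  qed auto
  moreover have "{1..c} \<union> {c+1..s} = {1..s}" using c by auto
  moreover have "S \<union> ({1..s} - S) = {1..s}" using S(2) by auto
  ultimately have "bij_betw ?\<pi> {1..s} {1..s}" by simp
  moreover have "Q (?\<pi> i) (?\<pi> j)" if "1 \<le> i \<and> i \<le> c \<and> c < j \<and> j \<le> s" for i j
    using that Q[of "f i" "g j"] bij_betwE[OF f] bij_betwE[OF g] by auto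
  ultimately show ?L using c by (intro exI[of _ ?\<pi>] exI[of _ c] conjI allI impI)
qed

theorem lemma3p4:
  fixes P :: "nat \<Rightarrow> ('n::finite, 'k::field) mpoly set"
    and I :: "('n, 'k) mpoly set"
    and s :: nat and q :: enat
  assumes s: "s \<ge> 3"
    and prime: "\<forall>i\<in>{1..s}. monomial_prime_ideal (P i)"
    and I: "I = (\<Inter>i\<in>{1..s}. P i)"
    and reduced: "\<forall>i\<in>{1..s}. (\<Inter>j\<in>{1..s} - {i}. P j) \<noteq> (\<Inter>j\<in>{1..s}. P j)"
    and sum: "ideal_sum mpoly_ring {1..s} P = vars_ideal"
    and q: "q = Min {krull_dim (mpoly_ring Quot (P i <+>\<^bsub>mpoly_ring\<^esub> P j)) | i j.
                 i \<in> {1..s} \<and> j \<in> {1..s} \<and> i \<noteq> j \<and> P i <+>\<^bsub>mpoly_ring\<^esub> P j \<noteq> vars_ideal}"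
    and size: "big_size s P = 2"
    and property: "\<forall>i\<in>{1..s}. \<forall>j\<in>{1..s}.
        i \<noteq> j \<and> P i <+>\<^bsub>mpoly_ring\<^esub> P j \<noteq> vars_ideal \<longrightarrow>
        (\<exists>k\<in>{1..s} - {i, j}. \<exists>e\<in>{1..s} - {i, j}.
           k \<noteq> e \<and> P k <+>\<^bsub>mpoly_ring\<^esub> P e \<noteq> vars_ideal)"
  shows "depth mpoly_ring vars_ideal (quot_module mpoly_ring I) \<in> {1, 2, 1 + q}
    \<and> (depth mpoly_ring vars_ideal (quot_module mpoly_ring I) = 1 \<longleftrightarrow>
        (\<exists>\<pi> c. bij_betw \<pi> {1..s} {1..s} \<and> 1 \<le> c \<and> c < s \<and>
           (\<forall>i j. 1 \<le> i \<and> i \<le> c \<and> c < j \<and> j \<le> s \<longrightarrow>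
              P (\<pi> i) <+>\<^bsub>mpoly_ring\<^esub> P (\<pi> j) = vars_ideal)))"
proof -
  let ?N = "{1..s}"
  have "\<exists>A. P i = var_ideal A" if "i \<in> ?N" for i
    using prime that unfolding monomial_prime_ideal_def genideal_mpoly by blast
  then obtain A where A: "\<And>i. i \<in> ?N \<Longrightarrow> P i = var_ideal (A i)" by metis
  define F where "F i = - A i" for i
  have P: "P i = var_ideal (- F i)" if "i \<in> ?N" for i using A[OF that] by (simp add: F_def)
  have add: "P i <+>\<^bsub>mpoly_ring\<^esub> P j = var_ideal (- (F i \<inter> F j))" if "i \<in> ?N" "j \<in> ?N" for i j
  proof -
    have "P i <+>\<^bsub>mpoly_ring\<^esub> P j = ideal_hull (var_ideal (- F i) \<union> var_ideal (- F j))"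
      unfolding mpoly_ring_def P[OF that(1)] P[OF that(2)] by (rule set_add_eq_hull) simp_all
    also have "\<dots> = var_ideal (- F i \<union> - F j)"
      unfolding ideal_hull_pvar[symmetric] ideal_hull_hull_Un ideal_hull_Un_hull image_Un ..
    finally show ?thesis by (simp add: Compl_Int)
  qed
  have nonmax: "P i <+>\<^bsub>mpoly_ring\<^esub> P j = vars_ideal \<longleftrightarrow> F i \<inter> F j = {}" if "i \<in> ?N" "j \<in> ?N" for i j
  proof -
    have "var_ideal (- (F i \<inter> F j)) = (var_ideal UNIV :: ('n, 'k) mpoly set) \<longleftrightarrow> - (F i \<inter> F j) = UNIV"
      by (metis subset_antisym subset_refl var_ideal_subset_iff)
    then show ?thesis unfolding add[OF that] vars_ideal_eq by auto
  qed
  interpret sparse_facets ?N F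
  proof
    show "\<not> F i \<subseteq> F j" if ij: "i \<in> ?N" "j \<in> ?N" "i \<noteq> j" for i j
    proof
      assume "F i \<subseteq> F j"
      then have "P j \<subseteq> P i" using var_ideal_mono[of "- F j" "- F i"] P ij by auto
      then have "(\<Inter>k\<in>?N - {i}. P k) = (\<Inter>k\<in>?N. P k)" using ij by blast
      then show False using reduced ij(1) by blast
    qed
    show "F i \<inter> F j \<inter> F k = {}"
      if ijk: "i \<in> ?N" "j \<in> ?N" "k \<in> ?N" "i \<noteq> j" "i \<noteq> k" "j \<noteq> k" for i j k
    proof -
      define good where "good t \<longleftrightarrow> t < s \<and>
        (\<forall>T\<subseteq>?N. card T = t + 1 \<longrightarrow> ideal_sum mpoly_ring T P = vars_ideal)" for t
      \<comment> \<open>The least element is only meaningful because the set is nonempty: \<open>s - 1\<close>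
             belongs to it by the assumption on the sum of all \<open>P i\<close>.\<close>
      have "good (s - 1)"
        unfolding good_def
      proof (intro conjI allI impI)
        fix T assume "T \<subseteq> ?N" "card T = s - 1 + 1"
        then have "T = ?N" using s by (intro card_subset_eq) auto
        then show "ideal_sum mpoly_ring T P = vars_ideal" using sum by simp
      qed (use s in simp)
      then have "good (big_size s P)" unfolding big_size_def good_def by (rule LeastI)
      then have "ideal_sum mpoly_ring {i, j, k} P = vars_ideal"
        using ijk unfolding size good_def by auto
      moreover have "ideal_sum mpoly_ring {i, j, k} P \<subseteq> var_ideal (- (F i \<inter> F j \<inter> F k))"
        unfolding mpoly_ring_def
      proof (rule ideal_sum_subset)
        fix l assume "l \<in> {i, j, k}"
        then show "P l \<subseteq> var_ideal (- (F i \<inter> F j \<inter> F k))"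
          using P ijk(1-3) var_ideal_mono[of "- F l" "- (F i \<inter> F j \<inter> F k)"] by auto
      qed simp_all
      ultimately show ?thesis
        unfolding vars_ideal_eq by (auto simp: var_ideal_subset_iff)
    qed
  qed simp
  have I_eq: "I = face_ideal ?N" unfolding I face_ideal_def using P by auto
  have split: "(\<exists>\<pi> c. bij_betw \<pi> ?N ?N \<and> 1 \<le> c \<and> c < s \<and>
           (\<forall>i j. 1 \<le> i \<and> i \<le> c \<and> c < j \<and> j \<le> s \<longrightarrow>
              P (\<pi> i) <+>\<^bsub>mpoly_ring\<^esub> P (\<pi> j) = vars_ideal)) \<longleftrightarrow> \<not> connected_on ?N"
  proof -
    have "(\<forall>i\<in>S. \<forall>j\<in>?N - S. P i <+>\<^bsub>mpoly_ring\<^esub> P j = vars_ideal)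
        \<longleftrightarrow> (\<forall>i\<in>S. \<forall>j\<in>?N - S. F i \<inter> F j = {})" if S: "S \<subset> ?N" for S
    proof (intro ball_cong refl)
      fix i j assume "i \<in> S" "j \<in> ?N - S"
      then have "i \<in> ?N" "j \<in> ?N" using S by auto
      then show "P i <+>\<^bsub>mpoly_ring\<^esub> P j = vars_ideal \<longleftrightarrow> F i \<inter> F j = {}" by (rule nonmax)
    qed
    then have "(\<exists>S. S \<noteq> {} \<and> S \<subset> ?N \<and> (\<forall>i\<in>S. \<forall>j\<in>?N - S. P i <+>\<^bsub>mpoly_ring\<^esub> P j = vars_ideal))
        \<longleftrightarrow> (\<exists>S. S \<noteq> {} \<and> S \<subset> ?N \<and> (\<forall>i\<in>S. \<forall>j\<in>?N - S. F i \<inter> F j = {}))"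
      by (intro ex_cong1 conj_cong refl)
    also have "\<dots> \<longleftrightarrow> \<not> connected_on ?N"
      unfolding connected_on_def by simp
    finally show ?thesis
      by (rule trans[OF ex_renumbering_iff[where Q = "\<lambda>i j. P i <+>\<^bsub>mpoly_ring\<^esub> P j = vars_ideal"]])
  qed
  define d where "d = depth mpoly_ring vars_ideal (quot_module mpoly_ring I)"
  have "d \<in> {1, 2, 1 + q} \<and> (d = 1 \<longleftrightarrow> \<not> connected_on ?N)"
  proof (cases "connected_on ?N")
    case False
    have "d = 1" unfolding d_def I_eq using False by (rule depth_disconnected)
    then show ?thesis using False by simp
  next
    case True
    have "{1} \<subseteq> ?N" "?N \<noteq> {1}" using s by simp_all
    then have "{1} \<subset> ?N" by (rule psubsetI[OF _ not_sym])
    then obtain i0 j0 where ij0: "i0 \<in> {1}" "j0 \<in> ?N - {1}" "F i0 \<inter> F j0 \<noteq> {}"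
      by (rule connected_onE[OF True insert_not_empty])
    have "d \<in> {2, 1 + q} \<and> d \<noteq> 1"
    proof (cases "\<exists>a\<in>?N. \<exists>b\<in>?N. a \<noteq> b \<and> F a \<inter> F b \<noteq> {} \<and> \<not> bridge a b")
      case nb: True
      then obtain a b where ab: "a \<in> ?N" "b \<in> ?N" "a \<noteq> b" "F a \<inter> F b \<noteq> {}" "\<not> bridge a b" by blast
      have "d = 2" unfolding d_def I_eq by (rule depth_non_bridge[OF True ab])
      then show ?thesis by simp
    next
      case bridges: False
      define E where "E = {(i, j). i \<in> ?N \<and> j \<in> ?N \<and> i \<noteq> j \<and> F i \<inter> F j \<noteq> {}}"
      have "E \<subseteq> ?N \<times> ?N" by (auto simp: E_def)
      then have finE: "finite E" by (rule finite_subset) simp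
      have "i0 \<in> ?N" using ij0(1) s by simp
      then have "(i0, j0) \<in> E" using ij0 by (auto simp: E_def)
      then have "E \<noteq> {}" by blast
      let ?w = "\<lambda>(i, j). card (F i \<inter> F j)"
      obtain e where e: "e \<in> E" "\<And>x. x \<in> E \<Longrightarrow> ?w e \<le> ?w x"
        using arg_min_if_finite[OF finE \<open>E \<noteq> {}\<close>, of ?w] by (metis not_le)
      obtain a b where e_eq: "e = (a, b)" by (cases e)
      have ab: "a \<in> ?N" "b \<in> ?N" "a \<noteq> b" "F a \<inter> F b \<noteq> {}" using e(1) by (auto simp: E_def e_eq)
      have min: "card (F a \<inter> F b) \<le> card (F i \<inter> F j)"
        if "i \<in> ?N" "j \<in> ?N" "i \<noteq> j" "F i \<inter> F j \<noteq> {}" for i j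
        using e(2)[of "(i, j)"] that by (simp add: E_def e_eq)
      have "d = enat (card (F a \<inter> F b) + 1)"
        unfolding d_def I_eq by (rule depth_tree[OF True ab min]) (use bridges in blast)+
      moreover have "q = enat (card (F a \<inter> F b))"
      proof -
        have dim: "krull_dim (mpoly_ring Quot (P i <+>\<^bsub>mpoly_ring\<^esub> P j)) = enat (card (F i \<inter> F j))"
          if "i \<in> ?N" "j \<in> ?N" for i j
          unfolding add[OF that] krull_dim_quot_var_ideal by simp
        have "{krull_dim (mpoly_ring Quot (P i <+>\<^bsub>mpoly_ring\<^esub> P j)) | i j.
                 i \<in> ?N \<and> j \<in> ?N \<and> i \<noteq> j \<and> P i <+>\<^bsub>mpoly_ring\<^esub> P j \<noteq> vars_ideal}
          = (\<lambda>x. enat (?w x)) ` E" (is "?D = _")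
        proof
          show "?D \<subseteq> (\<lambda>x. enat (?w x)) ` E"
          proof clarify
            fix i j assume ij: "i \<in> ?N" "j \<in> ?N" "i \<noteq> j" "P i <+>\<^bsub>mpoly_ring\<^esub> P j \<noteq> vars_ideal"
            then have "(i, j) \<in> E" using nonmax by (simp add: E_def)
            then show "krull_dim (mpoly_ring Quot (P i <+>\<^bsub>mpoly_ring\<^esub> P j)) \<in> (\<lambda>x. enat (?w x)) ` E"
              unfolding dim[OF ij(1,2)] by (rule rev_image_eqI) simp
          qed
          show "(\<lambda>x. enat (?w x)) ` E \<subseteq> ?D"
          proof clarify
            fix i j assume "(i, j) \<in> E"
            then have ij: "i \<in> ?N" "j \<in> ?N" "i \<noteq> j" "F i \<inter> F j \<noteq> {}" by (auto simp: E_def)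
            then have "P i <+>\<^bsub>mpoly_ring\<^esub> P j \<noteq> vars_ideal" using nonmax by simp
            then show "\<exists>i' j'. enat (card (F i \<inter> F j)) = krull_dim (mpoly_ring Quot (P i' <+>\<^bsub>mpoly_ring\<^esub> P j')) \<and>
               i' \<in> ?N \<and> j' \<in> ?N \<and> i' \<noteq> j' \<and> P i' <+>\<^bsub>mpoly_ring\<^esub> P j' \<noteq> vars_ideal"
              using ij dim[OF ij(1,2)] by (intro exI[of _ i] exI[of _ j]) simp
          qed
        qed
        moreover have "Min ((\<lambda>x. enat (?w x)) ` E) = enat (?w e)"
          using finE e by (intro Min_eqI) auto
        ultimately show ?thesis unfolding q by (simp add: e_eq)
      qed
      moreover have "card (F a \<inter> F b) \<noteq> 0" using ab(4) by simp
      ultimately show ?thesis by (simp add: one_enat_def)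
    qed
    then show ?thesis using True by blast
  qed
  then show ?thesis unfolding split d_def .
qed

end
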